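(* Let $X$ be a (nonempty) compact Hausdorff space, $\alpha:X\to X$ a continuous map that is a finite-sheeted cover on $X_\alpha$, i.e. $\sup_{x\in X_\alpha}|\alpha^{-1}(x)\cap X_\alpha|<\infty$, and $a\in C(X)$ a nonnegative function. Then $$\max_{\mu\in M_\alpha(X)}\int_X\ln a\,d\mu=\max_{\mu\in EM_\alpha(X)}\int_X\ln a\,d\mu\ \le\ \ell(\alpha,a)\ \le\ \max_{\mu\in EM_\alpha(X)}\int_X\ln a\,d\mu+\omega(\alpha).$$
   Context: $M_\alpha(X)$ is the set of regular Borel $\alpha$-invariant probability measures on $X$, and $EM_\alpha(X)\subset M_\alpha(X)$ is the set of ergodic ones. Convention: $\ln0=-\infty$, so integrals of $\ln a$ take values in $[-\infty,\infty)$. A point $x\in X$ is essential if every neighborhood $V$ of $x$ satisfies $\mu(V)>0$ for some $\mu\in M_\alpha(X)$; $X_\alpha$ is the (closed) set of essential points. It satisfies $\alpha(X_\alpha)=X_\alpha$ and contains the support of every $\mu\in M_\alpha(X)$. For $x\in X_\alpha$ put $\tilde\alpha^{-n}(x):=\alpha^{-n}(x)\cap X_\alpha$. Inverse rami-rate: $\omega(\alpha):=\ln\limsup_{n\to\infty}\sup_{x\in X_\alpha}|\tilde\alpha^{-n}(x)|^{1/n}$. Essential spectral potential: $$\ell(\alpha,a):=\ln\lim_{n\to\infty}\sup_{x\in X_\alpha}\Bigl(\sum_{y\in\tilde\alpha^{-n}(x)}\prod_{i=0}^{n-1}a(\alpha^i(y))\Bigr)^{1/n}.$$ *)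

theory Defs
  imports "HOL-Probability.Probability"
begin

(* The space X is a type of class t2_space; its compactness is assumed as compact UNIV. *)

section \<open>Regular Borel invariant probability measures\<close>

definition regular_borel_measure :: "'a::topological_space measure \<Rightarrow> bool" where
  "regular_borel_measure \<mu> \<longleftrightarrow> sets \<mu> = sets borel \<and>
     (\<forall>A\<in>sets borel.
        emeasure \<mu> A = (SUP K\<in>{K. compact K \<and> K \<in> sets borel \<and> K \<subseteq> A}. emeasure \<mu> K) \<and>
        emeasure \<mu> A = (INF U\<in>{U. open U \<and> A \<subseteq> U}. emeasure \<mu> U))"

definition invariant_measures :: "('a::topological_space \<Rightarrow> 'a) \<Rightarrow> 'a measure set" where
  "invariant_measures \<alpha> = {\<mu>. prob_space \<mu> \<and> regular_borel_measure \<mu> \<and>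
     (\<forall>A\<in>sets borel. emeasure \<mu> (\<alpha> -` A) = emeasure \<mu> A)}"

definition ergodic_measures :: "('a::topological_space \<Rightarrow> 'a) \<Rightarrow> 'a measure set" where
  "ergodic_measures \<alpha> = {\<mu> \<in> invariant_measures \<alpha>.
     \<forall>A\<in>sets borel. \<alpha> -` A = A \<longrightarrow> emeasure \<mu> A = 0 \<or> emeasure \<mu> A = 1}"

section \<open>Extended logarithm and extended integral\<close>

definition ln_ereal :: "ereal \<Rightarrow> ereal" where
  "ln_ereal x = (if x \<le> 0 then -\<infinity> else if x = \<infinity> then \<infinity> else ereal (ln (real_of_ereal x)))"

(* Positive part minus negative part, since e2ennreal sends negative numbers to 0.
   The integrands below are bounded above and the measures finite, so that the
   first term is finite and no difference of two infinities arises. *)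
definition ereal_integral :: "'a measure \<Rightarrow> ('a \<Rightarrow> ereal) \<Rightarrow> ereal" where
  "ereal_integral \<mu> f = enn2ereal (\<integral>\<^sup>+ x. e2ennreal (f x) \<partial>\<mu>) - enn2ereal (\<integral>\<^sup>+ x. e2ennreal (- f x) \<partial>\<mu>)"

definition integral_ln :: "('a \<Rightarrow> real) \<Rightarrow> 'a measure \<Rightarrow> ereal" where
  "integral_ln a \<mu> = ereal_integral \<mu> (\<lambda>x. ln_ereal (ereal (a x)))"

section \<open>Essential points\<close>

definition essential_set :: "('a::topological_space \<Rightarrow> 'a) \<Rightarrow> 'a set" where
  "essential_set \<alpha> = {x. \<forall>V. open V \<and> x \<in> V \<longrightarrow> (\<exists>\<mu>\<in>invariant_measures \<alpha>. emeasure \<mu> V > 0)}"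

definition ess_preimage :: "('a::topological_space \<Rightarrow> 'a) \<Rightarrow> nat \<Rightarrow> 'a \<Rightarrow> 'a set" where
  "ess_preimage \<alpha> n x = (\<alpha> ^^ n) -` {x} \<inter> essential_set \<alpha>"

(* Finiteness is explicit because card is 0 on infinite sets. As \<alpha> maps the essential
   set onto itself, N ^ n then bounds the n-th essential preimages of each essential point;
   these are finite, and no card or sum below is degenerate. *)
definition finite_sheeted_on_essential :: "('a::topological_space \<Rightarrow> 'a) \<Rightarrow> bool" where
  "finite_sheeted_on_essential \<alpha> \<longleftrightarrow>
     (\<exists>N. \<forall>x\<in>essential_set \<alpha>.
        finite (\<alpha> -` {x} \<inter> essential_set \<alpha>) \<and> card (\<alpha> -` {x} \<inter> essential_set \<alpha>) \<le> N)"

section \<open>Inverse rami-rate and essential spectral potential\<close>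

(* Suprema and limits are taken in ereal; the terms with n = 0 (where root 0 is 0) are irrelevant. *)

definition inverse_rami_rate :: "('a::topological_space \<Rightarrow> 'a) \<Rightarrow> ereal" where
  "inverse_rami_rate \<alpha> = ln_ereal (limsup (\<lambda>n.
     SUP x\<in>essential_set \<alpha>. ereal (root n (real (card (ess_preimage \<alpha> n x))))))"

definition essential_spectral_potential ::
    "('a::topological_space \<Rightarrow> 'a) \<Rightarrow> ('a \<Rightarrow> real) \<Rightarrow> ereal" where
  "essential_spectral_potential \<alpha> a = ln_ereal (lim (\<lambda>n.
     SUP x\<in>essential_set \<alpha>.
       ereal (root n (\<Sum>y\<in>ess_preimage \<alpha> n x. \<Prod>i<n. a ((\<alpha> ^^ i) y)))))"

(* For possibly infinite sets, unlike Max. *)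
definition is_maximum :: "'a::order set \<Rightarrow> 'a \<Rightarrow> bool" where
  "is_maximum S m \<longleftrightarrow> m \<in> S \<and> (\<forall>s\<in>S. s \<le> m)"

end

theory Submission
  imports Defs
begin

text \<open>By the Riesz representation theorem, invariant measures correspond to the invariant states on
  \<open>C(X)\<close>, which form a compact set. The functional \<open>\<mu> \<mapsto> \<integral> ln a d\<mu>\<close> is the infimum of the continuous
  functionals given by the truncations \<open>max (ln a) (-k)\<close>, so it attains its maximum, and the
  maximizers form a closed face. An extreme point of this face is an extreme invariant state, that is, an
  ergodic measure.

  For the lower bound, \<open>a(y) a(\<alpha> y) \<cdots> a(\<alpha>\<^sup>n\<^sup>-\<^sup>1 y)\<close> is one term of the sum over the preimages of
  \<open>\<alpha>\<^sup>n y\<close>; integrate its logarithm against an invariant measure. For the upper bound, the sum is at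
  most the number of preimages times the largest such product, and by a limit of empirical measures
  these products grow at most like \<open>e\<^sup>t\<^sup>n\<close> for every \<open>t\<close> above the maximum.\<close>

section \<open>Regular measures on a compact Hausdorff space\<close>

text \<open>\<open>X\<close> need not be metrizable or second countable, and \<open>ln a\<close> may
  equal -infinity; both facts shape the argument. States are points of the product space of all
  functionals: compactness is then Tychonoff's theorem, and evaluations at a function are continuous
  affine coordinates that separate points, which is all that a Krein-Milman argument uses. Sequences
  of empirical measures need not have convergent subsequences, so cluster points are used, tested on
  closed sets of functionals. The functional being maximized is only upper semicontinuous; this
  suffices both for attaining the maximum and for passing estimates from empirical measures to a
  cluster point. Working with a face of maximizers produces ergodicity without an ergodic
  decomposition.\<close>

lemma urysohn_compact:
  fixes S T :: "'a::t2_space set"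
  assumes "compact (UNIV :: 'a set)" "closed S" "closed T" "S \<inter> T = {}"
  obtains f :: "'a \<Rightarrow> real" where "continuous_on UNIV f" "\<And>x. 0 \<le> f x" "\<And>x. f x \<le> 1"
    "\<And>x. x \<in> S \<Longrightarrow> f x = 0" "\<And>x. x \<in> T \<Longrightarrow> f x = 1"
proof -
  have H: "Hausdorff_space (euclidean :: 'a topology)"
    unfolding Hausdorff_space_def disjnt_def using hausdorff by fastforce
  have "compact_space (euclidean :: 'a topology)"
    using assms(1) by (simp add: compact_space_def)
  with H have N: "normal_space (euclidean :: 'a topology)"
    by (intro compact_Hausdorff_or_regular_imp_normal_space) auto
  obtain f where "continuous_map euclidean (top_of_set {0..1::real}) f" "f ` S \<subseteq> {0}" "f ` T \<subseteq> {1}"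
    by (rule Urysohn_lemma[OF N, of S T 0 1]) (use assms in \<open>auto simp: disjnt_def\<close>)
  then show ?thesis
    by (intro that[of f]) (auto simp: continuous_map_in_subtopology)
qed

lemma closed_preimage_ge:
  "continuous_on UNIV (f :: 'a::topological_space \<Rightarrow> real) \<Longrightarrow> closed {x. c \<le> f x}"
  by (rule closed_Collect_le) auto

lemma continuous_bounded:
  fixes f :: "'a::topological_space \<Rightarrow> real"
  assumes "compact (UNIV :: 'a set)" "continuous_on UNIV f"
  shows "\<exists>C>0. \<forall>x. \<bar>f x\<bar> \<le> C"
proof -
  have "bounded (f ` UNIV)"
    using assms by (intro compact_imp_bounded compact_continuous_image) auto
  then show ?thesis unfolding bounded_pos by auto
qed

lemma continuous_integrable:
  fixes f :: "'a::topological_space \<Rightarrow> real"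
  assumes "compact (UNIV :: 'a set)" "continuous_on UNIV f" "finite_measure \<mu>" "sets \<mu> = sets borel"
  shows "integrable \<mu> f"
proof -
  obtain C where "\<forall>x. \<bar>f x\<bar> \<le> C" using continuous_bounded[OF assms(1,2)] by blast
  moreover have "f \<in> borel_measurable \<mu>"
    using borel_measurable_continuous_onI[OF assms(2)] assms(4) by (simp cong: measurable_cong_sets)
  ultimately show ?thesis
    using assms(3) by (intro finite_measure.integrable_const_bound[where B=C]) auto
qed

text \<open>Approximating the complement of a set from inside by closed sets approximates the set
  itself from outside by open sets, because the total mass is finite. So a single inner condition
  yields both halves of regularity; closed sets are compact here.\<close>

lemma regular_borel_measureI:
  fixes \<mu> :: "'a::t2_space measure"
  assumes cpt: "compact (UNIV :: 'a set)" and fin: "finite_measure \<mu>" and sets: "sets \<mu> = sets borel"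
    and inner: "\<And>A e. A \<in> sets borel \<Longrightarrow> e > 0 \<Longrightarrow>
      \<exists>K. closed K \<and> K \<subseteq> A \<and> measure \<mu> A \<le> measure \<mu> K + e"
  shows "regular_borel_measure \<mu>"
  unfolding regular_borel_measure_def
proof (intro conjI ballI)
  interpret finite_measure \<mu> by fact
  fix A :: "'a set" assume A: "A \<in> sets borel"
  have sp: "space \<mu> = UNIV" using sets_eq_imp_space_eq[OF sets] by simp
  have compl: "measure \<mu> (- B) = measure \<mu> UNIV - measure \<mu> B" if "B \<in> sets borel" for B
    using finite_measure_compl[of B] that sets sp by (simp add: Compl_eq_Diff_UNIV)
  show "emeasure \<mu> A = (SUP K\<in>{K. compact K \<and> K \<in> sets borel \<and> K \<subseteq> A}. emeasure \<mu> K)"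
  proof (rule antisym)
    show "emeasure \<mu> A \<le> (SUP K\<in>{K. compact K \<and> K \<in> sets borel \<and> K \<subseteq> A}. emeasure \<mu> K)"
    proof (rule ennreal_le_epsilon)
      fix e :: real assume "e > 0"
      with inner[OF A] obtain K where K: "closed K" "K \<subseteq> A" "measure \<mu> A \<le> measure \<mu> K + e" by blast
      have "compact K" using K(1) cpt compact_Int_closed[OF cpt K(1)] by simp
      then have "emeasure \<mu> K \<le> (SUP K\<in>{K. compact K \<and> K \<in> sets borel \<and> K \<subseteq> A}. emeasure \<mu> K)"
        using K by (intro SUP_upper) auto
      moreover have "emeasure \<mu> A \<le> emeasure \<mu> K + ennreal e"
        using K(3) \<open>e > 0\<close> by (simp add: emeasure_eq_measure ennreal_plus[symmetric] del: ennreal_plus)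
      ultimately show "emeasure \<mu> A \<le>
          (SUP K\<in>{K. compact K \<and> K \<in> sets borel \<and> K \<subseteq> A}. emeasure \<mu> K) + ennreal e"
        by (meson add_right_mono order_trans)
    qed
  qed (use A sets in \<open>auto intro!: SUP_least emeasure_mono\<close>)
  show "emeasure \<mu> A = (INF U\<in>{U. open U \<and> A \<subseteq> U}. emeasure \<mu> U)"
  proof (rule antisym)
    show "(INF U\<in>{U. open U \<and> A \<subseteq> U}. emeasure \<mu> U) \<le> emeasure \<mu> A"
    proof (rule ennreal_le_epsilon)
      fix e :: real assume "e > 0"
      have "- A \<in> sets borel" using A by (simp add: borel_comp)
      with inner[of "- A"] \<open>e > 0\<close> obtain K where K: "closed K" "K \<subseteq> - A"
        "measure \<mu> (- A) \<le> measure \<mu> K + e" by blast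
      have "(INF U\<in>{U. open U \<and> A \<subseteq> U}. emeasure \<mu> U) \<le> emeasure \<mu> (- K)"
        using K by (intro INF_lower) auto
      also have "\<dots> \<le> emeasure \<mu> A + ennreal e"
        using K(1,3) \<open>e > 0\<close> compl[of A] compl[of K] A
        by (simp add: emeasure_eq_measure ennreal_plus[symmetric] del: ennreal_plus)
      finally show "(INF U\<in>{U. open U \<and> A \<subseteq> U}. emeasure \<mu> U) \<le> emeasure \<mu> A + ennreal e" .
    qed
  qed (use sets in \<open>auto intro!: INF_greatest emeasure_mono\<close>)
qed (rule sets)

lemma regular_borel_measure_inner:
  fixes \<mu> :: "'a::t2_space measure"
  assumes "regular_borel_measure \<mu>" "finite_measure \<mu>" "A \<in> sets borel" "e > 0"
  obtains K where "compact K" "K \<subseteq> A" "measure \<mu> A \<le> measure \<mu> K + e"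
proof -
  interpret finite_measure \<mu> by fact
  have "emeasure \<mu> A = (SUP K\<in>{K. compact K \<and> K \<in> sets borel \<and> K \<subseteq> A}. emeasure \<mu> K)"
    using assms(1,3) by (simp add: regular_borel_measure_def)
  moreover have "{} \<in> {K. compact K \<and> K \<in> sets borel \<and> K \<subseteq> A}" by simp
  ultimately obtain K where K: "compact K" "K \<subseteq> A" "emeasure \<mu> A < emeasure \<mu> K + ennreal e"
    using SUP_approx_ennreal[OF \<open>e > 0\<close>, of "{K. compact K \<and> K \<in> sets borel \<and> K \<subseteq> A}"
        "emeasure \<mu> A" "emeasure \<mu>"] emeasure_finite[of A] by (auto simp del: emeasure_finite)
  from less_imp_le[OF this(3)] have "measure \<mu> A \<le> measure \<mu> K + e"
    using \<open>e > 0\<close> by (simp add: emeasure_eq_measure ennreal_plus[symmetric] del: ennreal_plus)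
  with K show ?thesis using that by blast
qed

text \<open>A Urysohn function that is 1 on a compact \<open>K \<subseteq> U\<close> and 0 off
  \<open>U\<close> compares the two measures on open \<open>U\<close>; outer regularity carries
  equality to all Borel sets.\<close>

lemma regular_borel_measure_eqI:
  fixes \<mu> \<nu> :: "'a::t2_space measure"
  assumes cpt: "compact (UNIV :: 'a set)" and fin: "finite_measure \<mu>" "finite_measure \<nu>"
    and reg: "regular_borel_measure \<mu>" "regular_borel_measure \<nu>"
    and eq: "\<And>f :: 'a \<Rightarrow> real. continuous_on UNIV f \<Longrightarrow> integral\<^sup>L \<mu> f = integral\<^sup>L \<nu> f"
  shows "\<mu> = \<nu>"
proof -
  have le: "measure \<mu> U \<le> measure \<nu> U"
    if U: "open U" and fin: "finite_measure \<mu>" "finite_measure \<nu>"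
      and reg: "regular_borel_measure \<mu>" "regular_borel_measure \<nu>"
      and eq: "\<And>f :: 'a \<Rightarrow> real. continuous_on UNIV f \<Longrightarrow> integral\<^sup>L \<mu> f = integral\<^sup>L \<nu> f"
    for \<mu> \<nu> :: "'a measure" and U
  proof (rule field_le_epsilon)
    interpret m: finite_measure \<mu> by fact
    interpret n: finite_measure \<nu> by fact
    have s: "sets \<mu> = sets borel" "sets \<nu> = sets borel"
      using reg by (auto simp: regular_borel_measure_def)
    fix e :: real assume "e > 0"
    obtain K where K: "compact K" "K \<subseteq> U" "measure \<mu> U \<le> measure \<mu> K + e"
      using regular_borel_measure_inner[OF reg(1) fin(1) _ \<open>e > 0\<close>, of U] U by auto
    obtain f :: "'a \<Rightarrow> real" where f: "continuous_on UNIV f" "\<And>x. 0 \<le> f x" "\<And>x. f x \<le> 1"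
      "\<And>x. x \<in> - U \<Longrightarrow> f x = 0" "\<And>x. x \<in> K \<Longrightarrow> f x = 1"
      by (rule urysohn_compact[OF cpt, of "- U" K]) (use U K compact_imp_closed in auto)
    have mK: "K \<in> sets borel" "U \<in> sets borel" using K(1) U by (auto intro: borel_compact)
    have i: "integrable \<mu> (indicator K :: 'a \<Rightarrow> real)" "integrable \<nu> (indicator U :: 'a \<Rightarrow> real)"
      using mK s by (auto simp: integrable_indicator_iff m.emeasure_eq_measure n.emeasure_eq_measure)
    have "measure \<mu> K = (\<integral>x. indicator K x \<partial>\<mu>)" using mK s by simp
    also have "\<dots> \<le> integral\<^sup>L \<mu> f"
      using f s fin i by (intro integral_mono continuous_integrable[OF cpt] i) (auto simp: indicator_def)
    also have "\<dots> = integral\<^sup>L \<nu> f" using eq f(1) by blast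
    also have "\<dots> \<le> (\<integral>x. indicator U x \<partial>\<nu>)"
      using f s fin i by (intro integral_mono continuous_integrable[OF cpt] i) (auto simp: indicator_def)
    also have "\<dots> = measure \<nu> U" using mK s by simp
    finally show "measure \<mu> U \<le> measure \<nu> U + e" using K(3) by simp
  qed
  interpret m: finite_measure \<mu> by fact
  interpret n: finite_measure \<nu> by fact
  have open_eq: "emeasure \<mu> U = emeasure \<nu> U" if "open U" for U
    using le[OF that fin reg eq] le[OF that fin(2,1) reg(2,1) eq[symmetric]]
    by (simp add: m.emeasure_eq_measure n.emeasure_eq_measure)
  have s: "sets \<mu> = sets borel" "sets \<nu> = sets borel"
    using reg by (auto simp: regular_borel_measure_def)
  show ?thesis
  proof (rule measure_eqI)
    fix A assume "A \<in> sets \<mu>"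
    then have A: "A \<in> sets borel" using s by simp
    have "emeasure \<mu> A = (INF U\<in>{U. open U \<and> A \<subseteq> U}. emeasure \<mu> U)"
      using reg(1) A unfolding regular_borel_measure_def by blast
    also have "\<dots> = (INF U\<in>{U. open U \<and> A \<subseteq> U}. emeasure \<nu> U)"
      using open_eq by (intro INF_cong) auto
    also have "\<dots> = emeasure \<nu> A"
      using reg(2) A unfolding regular_borel_measure_def by metis
    finally show "emeasure \<mu> A = emeasure \<nu> A" .
  qed (use s in simp)
qed

section \<open>The Riesz representation theorem\<close>

text \<open>Requiring a state to vanish on discontinuous functions makes it determined by its
  values on continuous functions.\<close>

definition states :: "(('a::topological_space \<Rightarrow> real) \<Rightarrow> real) set" where
  "states = {L.
     (\<forall>f g. continuous_on UNIV f \<longrightarrow> continuous_on UNIV g \<longrightarrow> L (\<lambda>x. f x + g x) = L f + L g) \<and>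
     (\<forall>c f. continuous_on UNIV f \<longrightarrow> L (\<lambda>x. c * f x) = c * L f) \<and>
     (\<forall>f. continuous_on UNIV f \<longrightarrow> (\<forall>x. 0 \<le> f x) \<longrightarrow> 0 \<le> L f) \<and>
     L (\<lambda>x. 1) = 1 \<and>
     (\<forall>f. \<not> continuous_on UNIV f \<longrightarrow> L f = 0)}"

locale riesz =
  fixes L :: "('a::t2_space \<Rightarrow> real) \<Rightarrow> real"
  assumes cpt: "compact (UNIV :: 'a set)" and L: "L \<in> states"
begin

lemma L_add: "continuous_on UNIV f \<Longrightarrow> continuous_on UNIV g \<Longrightarrow> L (\<lambda>x. f x + g x) = L f + L g"
  and L_mult: "continuous_on UNIV f \<Longrightarrow> L (\<lambda>x. c * f x) = c * L f"
  and L_pos: "continuous_on UNIV f \<Longrightarrow> (\<And>x. 0 \<le> f x) \<Longrightarrow> 0 \<le> L f"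
  and L_one: "L (\<lambda>x. 1) = 1"
  and L_discontinuous: "\<not> continuous_on UNIV f \<Longrightarrow> L f = 0"
  using L by (auto simp: states_def)

lemma L_const: "L (\<lambda>x. c) = c"
  using L_mult[of "\<lambda>x. 1" c] L_one by simp

lemma L_diff: "continuous_on UNIV f \<Longrightarrow> continuous_on UNIV g \<Longrightarrow> L (\<lambda>x. f x - g x) = L f - L g"
  using L_add[of f "\<lambda>x. -1 * g x"] L_mult[of g "-1"] by (simp add: continuous_intros)

lemma L_mono:
  "continuous_on UNIV f \<Longrightarrow> continuous_on UNIV g \<Longrightarrow> (\<And>x. f x \<le> g x) \<Longrightarrow> L f \<le> L g"
  using L_diff[of g f] L_pos[of "\<lambda>x. g x - f x"] by (simp add: continuous_on_diff)

lemma L_sum: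
  "finite I \<Longrightarrow> (\<And>i. i \<in> I \<Longrightarrow> continuous_on UNIV (f i)) \<Longrightarrow> L (\<lambda>x. \<Sum>i\<in>I. f i x) = (\<Sum>i\<in>I. L (f i))"
  by (induction I rule: finite_induct) (simp_all add: L_const L_add continuous_on_sum)

section \<open>The content of open sets\<close>

definition dominated :: "'a set \<Rightarrow> ('a \<Rightarrow> real) set" where
  "dominated U = {f. continuous_on UNIV f \<and> (\<forall>x. 0 \<le> f x \<and> f x \<le> 1) \<and> (\<forall>x. x \<notin> U \<longrightarrow> f x = 0)}"

definition content :: "'a set \<Rightarrow> ennreal" where
  "content U = (SUP f\<in>dominated U. ennreal (L f))"

lemma zero_dominated: "(\<lambda>x. 0) \<in> dominated U"
  by (simp add: dominated_def)

lemma dominated_L_le: "f \<in> dominated U \<Longrightarrow> ennreal (L f) \<le> content U"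
  unfolding content_def by (rule SUP_upper)

lemma content_empty: "content {} = 0"
proof -
  have "dominated {} = {\<lambda>x. 0}" by (auto simp: dominated_def)
  then show ?thesis by (simp add: content_def L_const)
qed

lemma content_mono: "U \<subseteq> V \<Longrightarrow> content U \<le> content V"
  unfolding content_def by (rule SUP_subset_mono) (auto simp: dominated_def)

lemma content_le_1: "content U \<le> 1"
  unfolding content_def
proof (rule SUP_least)
  fix f assume "f \<in> dominated U"
  then have "L f \<le> L (\<lambda>x. 1)" by (intro L_mono) (auto simp: dominated_def)
  then show "ennreal (L f) \<le> 1" by (simp add: L_one)
qed

lemma content_UNIV: "content UNIV = 1"
proof (rule antisym)
  have "(\<lambda>x. 1) \<in> dominated UNIV" by (simp add: dominated_def)
  from dominated_L_le[OF this] show "1 \<le> content UNIV" by (simp add: L_one)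
qed (rule content_le_1)

text \<open>A function in \<open>dominated U\<close> vanishes off \<open>U\<close>, but its support
  may reach the boundary. Lowering it by \<open>e\<close> leaves a function carried by the closed
  set where \<open>f\<close> is at least \<open>e\<close>, so that compactness applies, while
  \<open>L\<close> loses at most \<open>e\<close>.\<close>

lemma truncation:
  assumes f: "f \<in> dominated U" and e: "e > 0"
  obtains g C where "g \<in> dominated U" "closed C" "C \<subseteq> U" "\<And>x. x \<notin> C \<Longrightarrow> g x = 0"
    "ennreal (L f) \<le> ennreal (L g) + ennreal e"
proof -
  define g where "g = (\<lambda>x. max (f x - e) 0)"
  define C where "C = {x. e \<le> f x}"
  have cf: "continuous_on UNIV f" and cg: "continuous_on UNIV g"
    using f by (auto simp: dominated_def g_def intro!: continuous_intros)
  have "f x - e \<le> 1" for x using f e by (simp add: dominated_def) (smt (verit))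
  then have g: "g \<in> dominated U" using f e cg by (auto simp: dominated_def g_def)
  have "L f \<le> L (\<lambda>x. g x + e)"
    using cf cg by (intro L_mono continuous_intros) (auto simp: g_def)
  also have "\<dots> = L g + e" using cg L_add[OF cg, of "\<lambda>x. e"] by (simp add: L_const)
  finally have "L f \<le> L g + e" .
  moreover have "0 \<le> L g" using cg by (intro L_pos) (auto simp: g_def)
  ultimately have "ennreal (L f) \<le> ennreal (L g) + ennreal e"
    using e by (simp add: ennreal_plus[symmetric] del: ennreal_plus)
  moreover have "closed C" unfolding C_def using cf by (rule closed_preimage_ge)
  moreover have "C \<subseteq> U" using f e by (force simp: C_def dominated_def)
  moreover have "g x = 0" if "x \<notin> C" for x using that by (auto simp: C_def g_def max_def)
  ultimately show ?thesis using that g by blast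
qed

text \<open>A function dominated by \<open>U \<union> V\<close> is cut into two pieces by a Urysohn function separating
  the parts of its support outside \<open>U\<close> and outside \<open>V\<close>.\<close>

lemma content_Un:
  assumes "open U" "open V"
  shows "content (U \<union> V) \<le> content U + content V"
  unfolding content_def[of "U \<union> V"]
proof (rule SUP_least, rule ennreal_le_epsilon)
  fix f and e :: real assume f: "f \<in> dominated (U \<union> V)" and e: "e > 0"
  obtain g C where g: "g \<in> dominated (U \<union> V)" "closed C" "C \<subseteq> U \<union> V" "\<And>x. x \<notin> C \<Longrightarrow> g x = 0"
    "ennreal (L f) \<le> ennreal (L g) + ennreal e"
    using truncation[OF f e] by blast
  obtain h :: "'a \<Rightarrow> real" where h: "continuous_on UNIV h" "\<And>x. 0 \<le> h x" "\<And>x. h x \<le> 1"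
    "\<And>x. x \<in> C - U \<Longrightarrow> h x = 0" "\<And>x. x \<in> C - V \<Longrightarrow> h x = 1"
    using urysohn_compact[OF cpt, of "C - U" "C - V"] g assms by blast
  have gb: "0 \<le> g x" "g x \<le> 1" "continuous_on UNIV g" for x using g(1) by (auto simp: dominated_def)
  define p where "p = (\<lambda>x. g x * h x)"
  define q where "q = (\<lambda>x. g x * (1 - h x))"
  have cp: "continuous_on UNIV p" "continuous_on UNIV q"
    unfolding p_def q_def using h(1) gb(3) by (auto intro!: continuous_intros)
  have "p x = 0" if "x \<notin> U" for x using h(4)[of x] g(4)[of x] that by (cases "x \<in> C") (auto simp: p_def)
  then have p: "p \<in> dominated U"
    using cp h(2,3) gb(1,2) unfolding dominated_def p_def by (auto intro: mult_le_one)
  have "q x = 0" if "x \<notin> V" for x using h(5)[of x] g(4)[of x] that by (cases "x \<in> C") (auto simp: q_def)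
  then have q: "q \<in> dominated V"
    using cp h(2,3) gb(1,2) unfolding dominated_def q_def by (auto intro: mult_le_one)
  have "L g = L (\<lambda>x. p x + q x)" by (simp add: p_def q_def algebra_simps)
  also have "\<dots> = L p + L q" using cp by (rule L_add)
  finally have "ennreal (L g) = ennreal (L p) + ennreal (L q)"
    using p q L_pos by (simp add: dominated_def)
  also have "\<dots> \<le> content U + content V" by (intro add_mono dominated_L_le p q)
  finally show "ennreal (L f) \<le> content U + content V + ennreal e"
    using g(5) by (meson add_right_mono order_trans)
qed

lemma content_finite_UN:
  "(\<And>i. open (U i)) \<Longrightarrow> content (\<Union>i<n. U i) \<le> (\<Sum>i<n. content (U i))" for n :: nat
proof (induction n)
  case (Suc n)
  have "content (\<Union>i<Suc n. U i) \<le> content (\<Union>i<n. U i) + content (U n)"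
    using content_Un[of "\<Union>i<n. U i" "U n"] Suc.prems by (simp add: lessThan_Suc Un_commute open_UN)
  also have "\<dots> \<le> (\<Sum>i<n. content (U i)) + content (U n)"
    using Suc by (intro add_right_mono) auto
  finally show ?case by simp
qed (simp add: content_empty)

text \<open>The closed carrier of a truncated function is compact, so finitely many
  \<open>U i\<close> cover it, which reduces the claim to finite subadditivity.\<close>

lemma content_UN:
  assumes "\<And>i::nat. open (U i)"
  shows "content (\<Union>i. U i) \<le> (\<Sum>i. content (U i))"
  unfolding content_def[of "\<Union>i. U i"]
proof (rule SUP_least, rule ennreal_le_epsilon)
  fix f and e :: real assume f: "f \<in> dominated (\<Union>i. U i)" and e: "e > 0"
  obtain g C where g: "g \<in> dominated (\<Union>i. U i)" "closed C" "C \<subseteq> (\<Union>i. U i)" "\<And>x. x \<notin> C \<Longrightarrow> g x = 0"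
    "ennreal (L f) \<le> ennreal (L g) + ennreal e"
    using truncation[OF f e] by blast
  have "compact C" using compact_Int_closed[OF cpt g(2)] by simp
  then obtain I where I: "finite I" "C \<subseteq> (\<Union>i\<in>I. U i)"
    by (rule compactE_image[of C UNIV U]) (use assms g(3) in simp_all)
  obtain n where n: "I \<subseteq> {..<n}" using finite_nat_bounded[OF I(1)] by (elim exE)
  have "C \<subseteq> (\<Union>i<n. U i)" using I(2) n by blast
  then have "g \<in> dominated (\<Union>i<n. U i)" using g(1,4) unfolding dominated_def by blast
  then have "ennreal (L g) \<le> content (\<Union>i<n. U i)" by (rule dominated_L_le)
  also have "\<dots> \<le> (\<Sum>i<n. content (U i))" using assms by (rule content_finite_UN)
  also have "\<dots> \<le> (\<Sum>i. content (U i))" by (rule sum_le_suminf) auto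
  finally show "ennreal (L f) \<le> (\<Sum>i. content (U i)) + ennreal e"
    using g(5) by (meson add_right_mono order_trans)
qed

section \<open>Outer measure and Caratheodory measurability\<close>

definition outer :: "'a set \<Rightarrow> ennreal" where
  "outer A = (INF U\<in>{U. open U \<and> A \<subseteq> U}. content U)"

lemma outer_le: "open U \<Longrightarrow> A \<subseteq> U \<Longrightarrow> outer A \<le> content U"
  unfolding outer_def by (rule INF_lower) auto

lemma outer_open: "open U \<Longrightarrow> outer U = content U"
  by (rule antisym) (auto simp: outer_def intro!: INF_greatest content_mono intro: INF_lower)

lemma outer_mono: "A \<subseteq> B \<Longrightarrow> outer A \<le> outer B"
  unfolding outer_def by (rule INF_superset_mono) auto

lemma outer_finite: "outer A < top"
  using outer_le[of UNIV A] content_UNIV by (simp add: le_less_trans ennreal_one_less_top)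

lemma outer_approx:
  assumes "e > 0"
  shows "\<exists>U. open U \<and> A \<subseteq> U \<and> content U < outer A + ennreal e"
proof -
  have "outer A \<noteq> \<infinity>" using outer_finite[of A] by simp
  from INF_approx_ennreal[OF assms outer_def this] show ?thesis by blast
qed

lemma outer_measure_space_outer: "outer_measure_space (Pow UNIV) outer"
  unfolding outer_measure_space_def
proof (intro conjI)
  show "positive (Pow UNIV) outer" by (simp add: positive_def outer_open content_empty)
  show "increasing (Pow UNIV) outer" by (simp add: increasing_def outer_mono)
  show "countably_subadditive (Pow UNIV) outer"
    unfolding countably_subadditive_def
  proof (intro allI impI, rule ennreal_le_epsilon)
    fix A :: "nat \<Rightarrow> 'a set" and e :: real assume e: "0 < e"
    have "\<exists>U. open U \<and> A n \<subseteq> U \<and> content U < outer (A n) + ennreal (e * (1/2)^Suc n)" for n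
      using e by (intro outer_approx) simp
    then have "\<exists>U. \<forall>n. open (U n) \<and> A n \<subseteq> U n \<and>
        content (U n) < outer (A n) + ennreal (e * (1/2)^Suc n)"
      by (intro choice allI)
    then obtain U where U: "\<forall>n. open (U n) \<and> A n \<subseteq> U n \<and>
        content (U n) < outer (A n) + ennreal (e * (1/2)^Suc n)" by (elim exE)
    have "outer (\<Union>i. A i) \<le> content (\<Union>i. U i)"
      using U by (intro outer_le open_UN UN_mono) auto
    also have "\<dots> \<le> (\<Sum>i. content (U i))" using U by (intro content_UN) auto
    also have "\<dots> \<le> (\<Sum>i. outer (A i) + ennreal (e * (1/2)^Suc i))"
      using U by (intro suminf_le summableI less_imp_le) auto
    also have "\<dots> = (\<Sum>i. outer (A i)) + (\<Sum>i. ennreal e * ennreal ((1/2) ^ Suc i))"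
      using e by (subst suminf_add[symmetric])
        (auto simp del: ennreal_suminf_cmult simp add: ennreal_mult[symmetric])
    also have "\<dots> = (\<Sum>i. outer (A i)) + ennreal e"
      unfolding ennreal_suminf_cmult
      by (subst suminf_ennreal_eq[OF zero_le_power power_half_series]) auto
    finally show "outer (\<Union>i. A i) \<le> (\<Sum>i. outer (A i)) + ennreal e" .
  qed
qed

text \<open>This is the nontrivial half of Caratheodory's condition. A function carried by a closed
  \<open>C \<subseteq> V \<inter> U\<close> and one dominated by \<open>V - C\<close> are nowhere
  both nonzero, so their sum is still dominated by \<open>V\<close>; and \<open>V - C\<close> is an
  open set containing \<open>A - U\<close>.\<close>

lemma outer_split_open:
  assumes U: "open U"
  shows "outer (A \<inter> U) + outer (A - U) \<le> outer A"
  unfolding outer_def[of A]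
proof (rule INF_greatest, clarify)
  fix V assume V: "open V" "A \<subseteq> V"
  have *: "ennreal (L f) + outer (A - U) \<le> content V" if f: "f \<in> dominated (V \<inter> U)" for f
  proof (rule ennreal_le_epsilon)
    fix e :: real assume e: "e > 0"
    obtain g C where g: "g \<in> dominated (V \<inter> U)" "closed C" "C \<subseteq> V \<inter> U" "\<And>x. x \<notin> C \<Longrightarrow> g x = 0"
      "ennreal (L f) \<le> ennreal (L g) + ennreal e"
      using truncation[OF f e] by blast
    have "ennreal (L g) + ennreal (L h) \<le> content V" if h: "h \<in> dominated (V - C)" for h
    proof -
      have "(\<lambda>x. g x + h x) \<in> dominated V"
        unfolding dominated_def
      proof (safe)
        show "continuous_on UNIV (\<lambda>x. g x + h x)"
          using g(1) h by (auto simp: dominated_def intro!: continuous_intros)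
        fix x
        show "0 \<le> g x + h x" "x \<notin> V \<Longrightarrow> g x + h x = 0" using g(1) h by (auto simp: dominated_def)
        show "g x + h x \<le> 1" using g(1,4) h by (cases "x \<in> C") (auto simp: dominated_def)
      qed
      from dominated_L_le[OF this] show ?thesis
        using g(1) h L_add[of g h] L_pos[of g] L_pos[of h] by (simp add: dominated_def)
    qed
    then have "ennreal (L g) + content (V - C) \<le> content V"
      unfolding content_def[of "V - C"] using zero_dominated[of "V - C"]
      by (subst ennreal_SUP_add_right) (auto intro!: SUP_least)
    moreover have "outer (A - U) \<le> content (V - C)"
      using V g(2,3) by (intro outer_le) auto
    ultimately have "ennreal (L g) + outer (A - U) \<le> content V"
      by (meson add_left_mono order_trans)
    then have "(ennreal (L g) + outer (A - U)) + ennreal e \<le> content V + ennreal e"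
      by (rule add_right_mono)
    moreover have "ennreal (L f) + outer (A - U) \<le> (ennreal (L g) + outer (A - U)) + ennreal e"
      using add_right_mono[OF g(5), of "outer (A - U)"] by (simp add: ac_simps)
    ultimately show "ennreal (L f) + outer (A - U) \<le> content V + ennreal e" by (rule order_trans[rotated])
  qed
  have "outer (A \<inter> U) \<le> content (V \<inter> U)" using V U by (intro outer_le) auto
  then have "outer (A \<inter> U) + outer (A - U) \<le> content (V \<inter> U) + outer (A - U)" by (rule add_right_mono)
  also have "\<dots> \<le> content V"
    unfolding content_def[of "V \<inter> U"] using zero_dominated[of "V \<inter> U"] *
    by (subst ennreal_SUP_add_left[symmetric]) (auto intro!: SUP_least)
  finally show "outer (A \<inter> U) + outer (A - U) \<le> content V" .
qed

definition riesz_measure :: "'a measure" where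
  "riesz_measure = measure_of UNIV (sets borel) outer"

lemma sets_riesz: "sets riesz_measure = sets borel"
  unfolding riesz_measure_def by (metis sets.sets_measure_of_eq space_borel)

text \<open>The Caratheodory-measurable sets form a sigma-algebra on which \<open>outer\<close> is a
  measure; containing the open sets, it contains the Borel sets. Only with this does
  \<open>measure_of\<close> in \<open>riesz_measure\<close> take the values of
  \<open>outer\<close>.\<close>

lemma measure_space_outer: "measure_space UNIV (sets borel) outer"
proof -
  interpret P: sigma_algebra "UNIV :: 'a set" "Pow UNIV" by (rule sigma_algebra_Pow)
  have ms: "measure_space UNIV (lambda_system UNIV (Pow UNIV) outer) outer"
    by (rule P.caratheodory_lemma[OF outer_measure_space_outer])
  have "outer A \<le> outer (A \<inter> U) + outer (A - U)" for A U
  proof -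
    have "subadditive (Pow UNIV) outer"
      using outer_measure_space_outer P.countably_subadditive_subadditive
      by (auto simp: outer_measure_space_def)
    from subadditiveD[OF this, of "A \<inter> U" "A - U"] show ?thesis
      by (auto simp: Int_Diff_disjoint Int_Diff_Un)
  qed
  then have "open U \<Longrightarrow> U \<in> lambda_system UNIV (Pow UNIV) outer" for U
    unfolding P.lambda_system_eq using outer_split_open[of U] by (auto intro: antisym)
  moreover have "sigma_algebra UNIV (lambda_system UNIV (Pow UNIV) outer)"
    using ms by (simp add: measure_space_def)
  ultimately have "sigma_sets UNIV {U. open U} \<subseteq> lambda_system UNIV (Pow UNIV) outer"
    by (intro sigma_algebra.sigma_sets_subset) auto
  then have "sets borel \<subseteq> lambda_system UNIV (Pow UNIV) outer"
    by (simp add: borel_def)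
  with ms show ?thesis
    using measure_down[OF ms] sets.sigma_algebra_axioms[of borel] by simp
qed

lemma emeasure_riesz: "A \<in> sets borel \<Longrightarrow> emeasure riesz_measure A = outer A"
  using measure_space_outer unfolding riesz_measure_def measure_space_def
  by (intro emeasure_measure_of_sigma) auto

lemma prob_space_riesz: "prob_space riesz_measure"
proof
  have "space riesz_measure = UNIV" using sets_eq_imp_space_eq[OF sets_riesz] by simp
  then show "emeasure riesz_measure (space riesz_measure) = 1"
    by (simp add: emeasure_riesz outer_open content_UNIV)
qed

lemma regular_riesz: "regular_borel_measure riesz_measure"
proof (rule regular_borel_measureI[OF cpt _ sets_riesz])
  interpret prob_space riesz_measure by (rule prob_space_riesz)
  show "finite_measure riesz_measure" by unfold_locales
  have sp: "space riesz_measure = UNIV" using sets_eq_imp_space_eq[OF sets_riesz] by simp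
  fix A :: "'a set" and e :: real assume A: "A \<in> sets borel" and e: "e > 0"
  have "- A \<in> sets borel" using A by (simp add: borel_comp)
  obtain U where U: "open U" "- A \<subseteq> U" "content U < outer (- A) + ennreal e"
    using outer_approx[OF e] by blast
  then have "emeasure riesz_measure U \<le> emeasure riesz_measure (- A) + ennreal e"
    using \<open>- A \<in> sets borel\<close> by (simp add: emeasure_riesz outer_open)
  then have "measure riesz_measure U \<le> measure riesz_measure (- A) + e"
    using e by (simp add: emeasure_eq_measure ennreal_plus[symmetric] del: ennreal_plus)
  then have "measure riesz_measure A \<le> measure riesz_measure (- U) + e"
    using prob_compl[of A] prob_compl[of U] A U(1) sets_riesz sp by (simp add: Compl_eq_Diff_UNIV)
  then show "\<exists>K. closed K \<and> K \<subseteq> A \<and> measure riesz_measure A \<le> measure riesz_measure K + e"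
    using U by (intro exI[of _ "- U"]) auto
qed

section \<open>The representation formula\<close>

lemma integrable_riesz: "continuous_on UNIV f \<Longrightarrow> integrable riesz_measure f" for f :: "'a \<Rightarrow> real"
  by (rule continuous_integrable[OF cpt _ prob_space.finite_measure[OF prob_space_riesz] sets_riesz])

text \<open>Slicing: \<open>n f = (\<Sum>k<n. min 1 (max 0 (n f - k)))\<close>, the \<open>k\<close>-th summand being dominated
  by the set where \<open>n f > k\<close>.\<close>

lemma sum_slices:
  "0 \<le> t \<Longrightarrow> t \<le> real n \<Longrightarrow> (\<Sum>k<n. min 1 (max 0 (t - real k))) = t"
proof (induction n)
  case (Suc n)
  show ?case
  proof (cases "t \<le> real n")
    case True
    then show ?thesis using Suc by simp
  next
    case False
    have "(\<Sum>k<n. min 1 (max 0 (t - real k))) = (\<Sum>k<n. 1)"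
      using False by (intro sum.cong) auto
    then show ?thesis using False Suc.prems by simp
  qed
qed simp

text \<open>The sum counts the integers \<open>k\<close> below both \<open>n\<close> and
  \<open>t\<close>, at most \<open>t\<close> rounded up. The excess 1 does not grow with
  \<open>n\<close> and so vanishes after division by \<open>n\<close>.\<close>

lemma sum_slices_bound:
  "0 \<le> t \<Longrightarrow> (\<Sum>k<n. if real k < t then 1 else 0) \<le> t + (1::real)"
proof (induction n)
  case (Suc n)
  show ?case
  proof (cases "real n < t")
    case True
    have "(\<Sum>k<n. if real k < t then 1 else 0) \<le> (\<Sum>k<n. 1::real)"
      by (intro sum_mono) auto
    then show ?thesis using True by simp
  next
    case False
    then show ?thesis using Suc by simp
  qed
qed simp

text \<open>\<open>L\<close> of a slice of \<open>real n * f\<close> is at most the measure of the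
  open level set on which the slice is positive, and the indicators of these level sets add up to at
  most \<open>real n * f + 1\<close>. A positive gap between the two sides, multiplied by a large
  \<open>n\<close>, would exceed the error 1.\<close>

lemma L_le_integral_unit:
  assumes f: "continuous_on UNIV f" "\<And>x. 0 \<le> f x" "\<And>x. f x \<le> 1"
  shows "L f \<le> integral\<^sup>L riesz_measure f"
proof -
  interpret prob_space riesz_measure by (rule prob_space_riesz)
  have *: "real n * L f \<le> real n * integral\<^sup>L riesz_measure f + 1" for n
  proof -
    let ?s = "\<lambda>k x. min 1 (max 0 (real n * f x - real k))"
    let ?U = "\<lambda>k. {x. real k < real n * f x}"
    have s: "continuous_on UNIV (?s k)" for k using f(1) by (intro continuous_intros)
    have oU: "open (?U k)" for k using f(1) by (intro open_Collect_less continuous_intros)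
    have "real n * L f = L (\<lambda>x. \<Sum>k<n. ?s k x)"
      using f by (subst sum_slices) (auto simp: L_mult mult_left_le)
    also have "\<dots> = (\<Sum>k<n. L (?s k))" using s by (intro L_sum) auto
    also have "\<dots> \<le> (\<Sum>k<n. measure riesz_measure (?U k))"
    proof (rule sum_mono)
      fix k
      have "?s k \<in> dominated (?U k)" using s[of k] by (auto simp: dominated_def)
      then have "ennreal (L (?s k)) \<le> emeasure riesz_measure (?U k)"
        using oU[of k] dominated_L_le by (simp add: emeasure_riesz outer_open)
      then show "L (?s k) \<le> measure riesz_measure (?U k)"
        by (simp add: emeasure_eq_measure)
    qed
    also have "\<dots> = (\<Sum>k<n. \<integral>x. indicator (?U k) x \<partial>riesz_measure)"
      using oU sets_riesz by simp
    also have "\<dots> = (\<integral>x. (\<Sum>k<n. indicator (?U k) x) \<partial>riesz_measure)"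
      using oU sets_riesz by (subst Bochner_Integration.integral_sum)
        (auto simp: integrable_indicator_iff emeasure_eq_measure)
    also have "\<dots> \<le> (\<integral>x. real n * f x + 1 \<partial>riesz_measure)"
    proof (rule integral_mono)
      show "integrable riesz_measure (\<lambda>x. \<Sum>k<n. indicator (?U k) x :: real)"
        using oU sets_riesz by (auto simp: integrable_indicator_iff emeasure_eq_measure)
      show "integrable riesz_measure (\<lambda>x. real n * f x + 1)"
        using f(1) by (intro integrable_riesz continuous_intros)
      have "(\<Sum>k<n. indicator (?U k) x) = (\<Sum>k<n. if real k < real n * f x then 1 else 0 :: real)" for x
        by (intro sum.cong) (auto simp: indicator_def)
      then show "(\<Sum>k<n. indicator (?U k) x) \<le> real n * f x + 1" for x
        using sum_slices_bound[of "real n * f x" n] f(2)[of x] by simp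
    qed
    also have "\<dots> = real n * integral\<^sup>L riesz_measure f + 1"
      using integrable_riesz[OF f(1)] prob_space by simp
    finally show ?thesis .
  qed
  show ?thesis
  proof (rule ccontr)
    assume "\<not> ?thesis"
    then have d: "L f - integral\<^sup>L riesz_measure f > 0" by simp
    obtain n where n: "1 < real n * (L f - integral\<^sup>L riesz_measure f)"
      using reals_Archimedean3[OF d] by blast
    have "real n * (L f - integral\<^sup>L riesz_measure f) \<le> 1"
      using *[of n] unfolding right_diff_distrib by linarith
    with n show False by linarith
  qed
qed

lemma L_le_integral:
  assumes f: "continuous_on UNIV f"
  shows "L f \<le> integral\<^sup>L riesz_measure f"
proof -
  interpret prob_space riesz_measure by (rule prob_space_riesz)
  obtain C where C: "C > 0" "\<forall>x. \<bar>f x\<bar> \<le> C" using continuous_bounded[OF cpt f] by blast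
  \<comment> \<open>An affine change of scale moves the values of \<open>f\<close> from [-C, C] to
    [0, 1]; constants have the same value under \<open>L\<close> and under the integral, so the
    inequality can be scaled back.\<close>
  let ?g = "\<lambda>x. (1 / (2 * C)) * (f x + C)"
  have "L ?g \<le> integral\<^sup>L riesz_measure ?g"
  proof (rule L_le_integral_unit)
    show "continuous_on UNIV ?g" using f by (intro continuous_intros)
    fix x
    have "0 \<le> f x + C" "f x + C \<le> 2 * C" using C(2)[rule_format, of x] by linarith+
    then show "0 \<le> ?g x" "?g x \<le> 1" using C(1) by simp_all
  qed
  moreover have "L ?g = (1 / (2 * C)) * (L f + C)"
    using f L_add[OF f, of "\<lambda>x. C"] L_mult[of "\<lambda>x. f x + C" "1 / (2 * C)"]
    by (simp add: L_const continuous_on_add)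
  moreover have "integral\<^sup>L riesz_measure ?g = (1 / (2 * C)) * (integral\<^sup>L riesz_measure f + C)"
    using integrable_riesz[OF f] prob_space C(1) by simp
  ultimately have "(1 / (2 * C)) * (L f + C) \<le> (1 / (2 * C)) * (integral\<^sup>L riesz_measure f + C)"
    by (simp only:)
  moreover have "0 < 1 / (2 * C)" using C(1) by simp
  ultimately show ?thesis using mult_le_cancel_left_pos[of "1 / (2 * C)"] by simp
qed

lemma integral_riesz:
  assumes f: "continuous_on UNIV f"
  shows "integral\<^sup>L riesz_measure f = L f"
proof (rule antisym)
  have "L (\<lambda>x. -1 * f x) \<le> integral\<^sup>L riesz_measure (\<lambda>x. -1 * f x)"
    using f by (intro L_le_integral continuous_intros)
  then show "integral\<^sup>L riesz_measure f \<le> L f" using L_mult[OF f, of "-1"] by simp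
qed (rule L_le_integral[OF f])

end

section \<open>Extreme points of compact sets of functionals\<close>

text \<open>Convexity of the ambient set plays no role, so faces are defined for arbitrary sets;
  taking \<open>1 - s\<close> for \<open>s\<close> shows that the second point lies in the face as well.\<close>

definition face :: "('i \<Rightarrow> real) set \<Rightarrow> ('i \<Rightarrow> real) set \<Rightarrow> bool" where
  "face K F \<longleftrightarrow> F \<subseteq> K \<and>
     (\<forall>x\<in>F. \<forall>y\<in>K. \<forall>z\<in>K. \<forall>s. 0 < s \<and> s < 1 \<and> (\<forall>i. x i = s * y i + (1 - s) * z i) \<longrightarrow> y \<in> F)"

lemma faceD:
  assumes "face K F" "x \<in> F" "y \<in> K" "z \<in> K" "0 < s" "s < 1" "\<And>i. x i = s * y i + (1 - s) * z i"
  shows "y \<in> F" "z \<in> F"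
proof -
  show "y \<in> F" using assms unfolding face_def by blast
  have "0 < 1 - s \<and> 1 - s < 1 \<and> (\<forall>i. x i = (1 - s) * z i + (1 - (1 - s)) * y i)"
    using assms by simp
  then show "z \<in> F" using assms(1-4) unfolding face_def by blast
qed

lemma face_Inter: "C \<noteq> {} \<Longrightarrow> (\<And>F. F \<in> C \<Longrightarrow> face K F) \<Longrightarrow> face K (\<Inter>C)"
  unfolding face_def by blast

lemma chain_Inter_nonempty:
  assumes "compact K" "C \<noteq> {}" "\<And>F. F \<in> C \<Longrightarrow> closed F \<and> F \<noteq> {} \<and> F \<subseteq> K"
    and chain: "\<And>F G. F \<in> C \<Longrightarrow> G \<in> C \<Longrightarrow> F \<subseteq> G \<or> G \<subseteq> F"
  shows "\<Inter>C \<noteq> {}"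
proof -
  have "K \<inter> \<Inter>C \<noteq> {}"
  proof (rule compact_imp_fip[OF assms(1)])
    fix C' assume C': "finite C'" "C' \<subseteq> C"
    show "K \<inter> \<Inter>C' \<noteq> {}"
    proof (cases "C' = {}")
      case True
      then show ?thesis using assms(2,3) by auto
    next
      case False
      obtain m where m: "m \<in> C'" "\<forall>b\<in>C'. b \<subseteq> m \<longrightarrow> m = b"
        using finite_has_minimal[OF C'(1) False] by blast
      have "m \<subseteq> b" if "b \<in> C'" for b using chain[of m b] m C'(2) that by auto
      moreover have "m \<noteq> {}" "m \<subseteq> K" using m(1) C'(2) assms(3) by auto
      ultimately show ?thesis by blast
    qed
  qed (simp add: assms(3))
  then show ?thesis by blast
qed

lemma continuous_on_coordinate: "continuous_on S (\<lambda>x :: 'i \<Rightarrow> real. x i)"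
  by (rule continuous_on_subset[OF continuous_on_product_coordinates]) simp

text \<open>Krein-Milman argument: Zorn gives a minimal closed face below \<open>F\<close>.
  Maximizing one coordinate over it cuts out a closed face inside it, so by minimality each
  coordinate is constant on it and it is a single point.\<close>

lemma face_contains_extreme_point:
  fixes K :: "('i \<Rightarrow> real) set"
  assumes K: "compact K" and F: "face K F" "closed F" "F \<noteq> {}"
  shows "\<exists>x\<in>F. face K {x}"
proof -
  define A where "A = {G. face K G \<and> closed G \<and> G \<noteq> {} \<and> G \<subseteq> F}"
  have "\<exists>m\<in>A. \<forall>a\<in>A. a \<subseteq> m \<longrightarrow> a = m"
  proof (rule predicate_Zorn[of A "\<lambda>X Y. Y \<subseteq> X"])
    show "partial_order_on A (relation_of (\<lambda>X Y. Y \<subseteq> X) A)"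
      by (rule partial_order_on_relation_ofI) auto
    fix C assume C: "C \<in> Chains (relation_of (\<lambda>X Y. Y \<subseteq> X) A)"
    have CA: "C \<subseteq> A" using Chains_relation_of[OF C] .
    have chain: "X \<subseteq> Y \<or> Y \<subseteq> X" if "X \<in> C" "Y \<in> C" for X Y
      using C that unfolding Chains_def relation_of_def by auto
    show "\<exists>u\<in>A. \<forall>a\<in>C. u \<subseteq> a"
    proof (cases "C = {}")
      case True
      then show ?thesis using F by (auto simp: A_def)
    next
      case False
      have "closed X \<and> X \<noteq> {} \<and> X \<subseteq> K" if "X \<in> C" for X
        using that CA by (auto simp: A_def face_def)
      then have "\<Inter>C \<noteq> {}" using chain by (rule chain_Inter_nonempty[OF K False])
      moreover have "face K (\<Inter>C)" using False CA by (intro face_Inter) (auto simp: A_def)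
      moreover have "closed (\<Inter>C)" using CA by (intro closed_Inter) (auto simp: A_def)
      moreover have "\<Inter>C \<subseteq> F" using False CA by (auto simp: A_def)
      ultimately have "\<Inter>C \<in> A" by (simp add: A_def)
      then show ?thesis by blast
    qed
  qed
  then obtain G where G: "G \<in> A" and min: "\<And>H. H \<in> A \<Longrightarrow> H \<subseteq> G \<Longrightarrow> H = G" by blast
  have fG: "face K G" and cG: "closed G" and neG: "G \<noteq> {}" and GF: "G \<subseteq> F" using G by (auto simp: A_def)
  have GK: "G \<subseteq> K" using fG by (simp add: face_def)
  have "compact G" using K cG GK by (metis compact_Int_closed inf.absorb2)
  have eq: "x i = y i" if x: "x \<in> G" and y: "y \<in> G" for x y i
  proof -
    obtain m where m: "m \<in> G" "\<forall>x\<in>G. x i \<le> m i"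
      using continuous_attains_sup[OF \<open>compact G\<close> neG continuous_on_coordinate] by blast
    define H where "H = G \<inter> {x. m i \<le> x i}"
    have "closed {x :: 'i \<Rightarrow> real. m i \<le> x i}"
      by (intro closed_Collect_le continuous_on_coordinate continuous_on_const)
    then have "closed H" using cG unfolding H_def by (rule closed_Int[rotated])
    moreover have "m \<in> H" using m by (simp add: H_def)
    moreover have "face K H"
      unfolding face_def
    proof (intro conjI ballI allI impI)
      show "H \<subseteq> K" using GK by (auto simp: H_def)
      fix x y z s assume *: "x \<in> H" "y \<in> K" "z \<in> K"
        "0 < s \<and> s < 1 \<and> (\<forall>i. x i = s * y i + (1 - s) * z i)"
      have "x \<in> G" and mx: "m i \<le> x i" using *(1) by (simp_all add: H_def)
      have s: "0 < s" "s < 1" "\<And>i. x i = s * y i + (1 - s) * z i" using *(4) by blast+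
      have yz: "y \<in> G" "z \<in> G" by (rule faceD[OF fG \<open>x \<in> G\<close> *(2,3) s])+
      \<comment> \<open>Neither endpoint exceeds the maximum \<open>m i\<close>, so their convex
        combination can reach it only if \<open>y i\<close> does.\<close>
      have "z i \<le> m i" using m yz by blast
      then have "(1 - s) * z i \<le> (1 - s) * m i" using s(2) by (intro mult_left_mono) auto
      moreover have "m i \<le> s * y i + (1 - s) * z i" using mx unfolding s(3) .
      ultimately have "s * m i \<le> s * y i" by (simp add: algebra_simps)
      then show "y \<in> H" using yz s(1) by (simp add: H_def)
    qed
    ultimately have "H \<in> A" using GF by (auto simp: A_def H_def)
    then have "H = G" by (rule min) (auto simp: H_def)
    then have "m i \<le> x i" "m i \<le> y i" using x y by (auto simp: H_def)
    moreover have "x i \<le> m i" "y i \<le> m i" using m x y by auto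
    ultimately show ?thesis by simp
  qed
  obtain x where "x \<in> G" using neG by blast
  moreover have "y = x" if "y \<in> G" for y by (rule ext) (rule eq[OF that \<open>x \<in> G\<close>])
  ultimately have "G = {x}" by blast
  with fG GF show ?thesis by auto
qed

text \<open>An infimum of continuous coordinates is upper semicontinuous, so its maximum is
  attained. Since the sequence decreases on \<open>K\<close>, the infimum also respects convex
  combinations, which makes the set of maximizers a face.\<close>

lemma extreme_point_maximizes:
  fixes K :: "('i \<Rightarrow> real) set" and \<phi> :: "nat \<Rightarrow> 'i"
  assumes K: "compact K" "K \<noteq> {}" "closed K"
    and dec: "\<And>x j k. x \<in> K \<Longrightarrow> j \<le> k \<Longrightarrow> x (\<phi> k) \<le> x (\<phi> j)"
  shows "\<exists>x\<in>K. face K {x} \<and> (\<forall>y\<in>K. (INF k. ereal (y (\<phi> k))) \<le> (INF k. ereal (x (\<phi> k))))"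
proof -
  define J where "J = (\<lambda>x :: 'i \<Rightarrow> real. INF k. ereal (x (\<phi> k)))"
  define M where "M = (SUP x\<in>K. J x)"
  have JM: "J x \<le> M" if "x \<in> K" for x unfolding M_def using that by (rule SUP_upper)
  have closed_J: "closed {x. t \<le> J x}" for t
  proof -
    have "{x. t \<le> J x} = (\<Inter>k. {x. t \<le> ereal (x (\<phi> k))})"
      by (auto simp: J_def le_INF_iff)
    moreover have "closed {x :: 'i \<Rightarrow> real. t \<le> ereal (x (\<phi> k))}" for k
      by (intro closed_Collect_le continuous_on_ereal continuous_on_coordinate continuous_on_const)
    ultimately show ?thesis by auto
  qed
  define F where "F = K \<inter> {x. M \<le> J x}"
  \<comment> \<open>The superlevel sets below the supremum \<open>M\<close> are closed and nested,
    so they have a common point in \<open>K\<close>.\<close>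
  have "K \<inter> (\<Inter>t\<in>{..<M}. {x. t \<le> J x}) \<noteq> {}"
  proof (rule compact_imp_fip_image[OF K(1) closed_J])
    fix I' assume I': "finite I'" "I' \<subseteq> {..<M}"
    show "K \<inter> (\<Inter>t\<in>I'. {x. t \<le> J x}) \<noteq> {}"
    proof (cases "I' = {}")
      case False
      then have "Max I' < M" using I' by auto
      then obtain x where "x \<in> K" "Max I' < J x" unfolding M_def less_SUP_iff by blast
      then have "x \<in> K \<inter> (\<Inter>t\<in>I'. {x. t \<le> J x})"
        using I' False Max_ge[OF I'(1)] by (auto intro: order_trans less_imp_le)
      then show ?thesis by blast
    qed (use K in simp)
  qed
  then obtain x0 where x0: "x0 \<in> K" "\<forall>t<M. t \<le> J x0" by auto
  have "M \<le> J x0" by (rule dense_le) (use x0(2) in blast)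
  with x0 have ne: "F \<noteq> {}" by (auto simp: F_def)
  have "closed F"
    unfolding F_def by (intro closed_Int K(3) closed_J)
  \<comment> \<open>The infimum lies below the coordinate at \<open>\<phi> 0\<close>, which is
    bounded on \<open>K\<close>.\<close>
  have "M \<noteq> \<infinity>"
  proof -
    obtain m where "\<forall>x\<in>K. x (\<phi> 0) \<le> m (\<phi> 0)"
      using continuous_attains_sup[OF K(1,2) continuous_on_coordinate] by blast
    then have "M \<le> ereal (m (\<phi> 0))"
      unfolding M_def J_def by (intro SUP_least INF_lower2[of 0]) auto
    then show ?thesis by auto
  qed
  have "face K F"
  proof (cases "M = -\<infinity>")
    \<comment> \<open>If the maximum is -infinity, every point of \<open>K\<close> maximizes and
      \<open>F\<close> is \<open>K\<close> itself.\<close>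
    case True
    then show ?thesis unfolding face_def F_def by auto
  next
    case False
    then obtain r where r: "M = ereal r" using \<open>M \<noteq> \<infinity>\<close> by (cases M) auto
    show ?thesis
      unfolding face_def
    proof (intro conjI ballI allI impI)
      show "F \<subseteq> K" by (auto simp: F_def)
      fix x y z s assume *: "x \<in> F" "y \<in> K" "z \<in> K"
        "0 < s \<and> s < 1 \<and> (\<forall>i. x i = s * y i + (1 - s) * z i)"
      have "M \<le> J y"
      proof (rule ccontr)
        assume "\<not> M \<le> J y"
        then have "J y < ereal r" using r by simp
        then obtain k0 where k0: "y (\<phi> k0) < r" unfolding J_def INF_less_iff by auto
        \<comment> \<open>\<open>e\<close> is the loss caused by \<open>y\<close> at
          \<open>k0\<close>, weighted by \<open>s\<close>. Since \<open>z\<close> exceeds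
          \<open>r\<close> by less than \<open>e\<close> from \<open>k1\<close> on, its weighted
          gain is below \<open>(1 - s) * e\<close> and cannot make up for the loss; at
          \<open>max k0 k1\<close> both bounds hold by monotonicity.\<close>
        define e where "e = s * (r - y (\<phi> k0))"
        have "e > 0" using k0 * by (simp add: e_def)
        have "J z < ereal (r + e)"
          using JM[OF *(3)] r \<open>e > 0\<close> by (auto intro: le_less_trans)
        then obtain k1 where k1: "z (\<phi> k1) < r + e" unfolding J_def INF_less_iff by auto
        define k where "k = max k0 k1"
        have yk: "y (\<phi> k) \<le> y (\<phi> k0)" and zk: "z (\<phi> k) < r + e"
          using dec[OF *(2), of k0 k] dec[OF *(3), of k1 k] k1 by (auto simp: k_def)
        have "r \<le> x (\<phi> k)"
        proof -
          have "M \<le> J x" using *(1) by (simp add: F_def)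
          also have "\<dots> \<le> ereal (x (\<phi> k))" unfolding J_def by (rule INF_lower) simp
          finally show ?thesis using r by simp
        qed
        also have "x (\<phi> k) = s * y (\<phi> k) + (1 - s) * z (\<phi> k)" using * by blast
        also have "\<dots> < s * y (\<phi> k0) + (1 - s) * (r + e)"
          using * yk zk by (intro add_le_less_mono mult_left_mono mult_strict_left_mono) auto
        also have "\<dots> = r - s * e" by (simp add: e_def algebra_simps)
        finally have "s * e < 0" by simp
        moreover have "0 < s * e" using * \<open>e > 0\<close> by simp
        ultimately show False by simp
      qed
      then show "y \<in> F" using * by (simp add: F_def)
    qed
  qed
  from face_contains_extreme_point[OF K(1) this \<open>closed F\<close> ne]
  obtain x where x: "x \<in> F" "face K {x}" by blast
  then have "x \<in> K" and "J y \<le> J x" if "y \<in> K" for y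
    using JM[OF that] by (auto simp: F_def intro: order_trans)
  then show ?thesis using x(2) K(2) unfolding J_def by blast
qed

section \<open>Invariant states\<close>

definition invariant_states :: "('a::topological_space \<Rightarrow> 'a) \<Rightarrow> (('a \<Rightarrow> real) \<Rightarrow> real) set" where
  "invariant_states \<alpha> = {L \<in> states. \<forall>f. continuous_on UNIV f \<longrightarrow> L (\<lambda>x. f (\<alpha> x)) = L f}"

text \<open>The premise does not involve \<open>x\<close>, so side conditions such as continuity of
  \<open>f\<close> in \<open>states\<close> do not disturb closedness.\<close>

lemma closed_imp_Collect: "(P \<Longrightarrow> closed {x. Q x}) \<Longrightarrow> closed {x. P \<longrightarrow> Q x}"
  by (cases P) auto

lemma closed_invariant_states: "closed (invariant_states \<alpha>)"
  unfolding invariant_states_def states_def mem_Collect_eq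
  by (intro closed_Collect_conj closed_Collect_all closed_imp_Collect closed_Collect_eq closed_Collect_le
      continuous_intros continuous_on_coordinate)

text \<open>By Tychonoff: monotonicity confines the value at a continuous function to the interval
  given by its bound, and the value at a discontinuous function is pinned to 0, so every coordinate
  ranges over a compact set.\<close>

lemma compact_invariant_states:
  fixes \<alpha> :: "'a::t2_space \<Rightarrow> 'a"
  assumes cpt: "compact (UNIV :: 'a set)"
  shows "compact (invariant_states \<alpha>)"
proof -
  have "\<exists>C. \<forall>f :: 'a \<Rightarrow> real. continuous_on UNIV f \<longrightarrow> (\<forall>x. \<bar>f x\<bar> \<le> C f)"
    using continuous_bounded[OF cpt] by metis
  then obtain C :: "('a \<Rightarrow> real) \<Rightarrow> real"
    where C: "\<And>f x. continuous_on UNIV f \<Longrightarrow> \<bar>f x\<bar> \<le> C f" by blast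
  define B where "B = (\<lambda>f :: 'a \<Rightarrow> real. if continuous_on UNIV f then {- C f .. C f} else {0})"
  have "compactin (product_topology (\<lambda>f :: 'a \<Rightarrow> real. euclideanreal) UNIV) (PiE UNIV B)"
    unfolding compactin_PiE by (auto simp: B_def)
  then have "compact (PiE UNIV B)"
    by (simp add: euclidean_product_topology)
  moreover have "invariant_states \<alpha> \<subseteq> PiE UNIV B"
  proof (clarsimp simp: PiE_UNIV_domain)
    fix L f assume "L \<in> invariant_states \<alpha>"
    then interpret riesz L
      using cpt by unfold_locales (auto simp: invariant_states_def)
    show "L f \<in> B f"
    proof (cases "continuous_on UNIV f")
      case True
      have "- C f \<le> f x" "f x \<le> C f" for x using C[OF True, of x] by auto
      then have "L f \<le> L (\<lambda>x. C f)" "L (\<lambda>x. - C f) \<le> L f"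
        using True by (auto intro!: L_mono)
      then show ?thesis using True by (simp add: B_def L_const)
    next
      case False
      then show ?thesis by (simp add: B_def L_discontinuous)
    qed
  qed
  ultimately show ?thesis
    using closed_invariant_states by (metis compact_Int_closed inf.absorb2)
qed

text \<open>Compactness of a product over an uncountable index set need not give a convergent
  subsequence. A cluster point retains what is needed: every closed condition that eventually holds
  along the sequence.\<close>

lemma compact_cluster:
  fixes s :: "nat \<Rightarrow> 'b::topological_space"
  assumes "compact B" "\<And>n. s n \<in> B"
  shows "\<exists>x\<in>B. \<forall>S. closed S \<longrightarrow> eventually (\<lambda>n. s n \<in> S) sequentially \<longrightarrow> x \<in> S"
proof -
  let ?F = "filtermap s sequentially"
  have "?F \<noteq> bot" by (simp add: filtermap_bot_iff)
  moreover have "eventually (\<lambda>x. x \<in> B) ?F" using assms(2) by (simp add: eventually_filtermap)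
  ultimately obtain x where x: "x \<in> B" "inf (nhds x) ?F \<noteq> bot"
    using assms(1) unfolding compact_filter by blast
  have "x \<in> S" if S: "closed S" and ev: "eventually (\<lambda>n. s n \<in> S) sequentially" for S
  proof (rule ccontr)
    assume "x \<notin> S"
    then have "eventually (\<lambda>y. y \<in> - S) (nhds x)" using S by (intro eventually_nhds_in_open) auto
    moreover have "eventually (\<lambda>y. y \<in> S) ?F" using ev by (simp add: eventually_filtermap)
    ultimately have "\<exists>Q R. eventually Q (nhds x) \<and> eventually R ?F \<and> (\<forall>y. Q y \<and> R y \<longrightarrow> False)"
      by (intro exI[of _ "\<lambda>y. y \<in> - S"] exI[of _ "\<lambda>y. y \<in> S"]) simp
    then have "eventually (\<lambda>_. False) (inf (nhds x) ?F)"
      unfolding eventually_inf .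
    then show False using x(2) by (simp add: eventually_False)
  qed
  then show ?thesis using x(1) by blast
qed

definition empirical :: "('a::topological_space \<Rightarrow> 'a) \<Rightarrow> 'a \<Rightarrow> nat \<Rightarrow> ('a \<Rightarrow> real) \<Rightarrow> real" where
  "empirical \<alpha> y n f = (if continuous_on UNIV f then (\<Sum>i<n. f ((\<alpha> ^^ i) y)) / real n else 0)"

lemma empirical_in_states: "n > 0 \<Longrightarrow> empirical \<alpha> y n \<in> states"
  unfolding states_def empirical_def
  by (auto simp: sum.distrib add_divide_distrib sum_distrib_left continuous_intros intro!: sum_nonneg divide_nonneg_nonneg)

text \<open>The Krylov-Bogolyubov construction: shifting an orbit average of length
  \<open>N j\<close> changes it only by two boundary terms, of total size at most
  \<open>2 * C / real (N j)\<close>, so a cluster point is invariant. The clause on closed sets lets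
  further estimates on the averages pass to the limit.\<close>

lemma empirical_limit:
  fixes \<alpha> :: "'a::t2_space \<Rightarrow> 'a"
  assumes cpt: "compact (UNIV :: 'a set)" and \<alpha>: "continuous_on UNIV \<alpha>" and N: "\<And>j. N j > j"
  shows "\<exists>L\<in>invariant_states \<alpha>. \<forall>S. closed S \<longrightarrow>
    eventually (\<lambda>j. empirical \<alpha> (y j) (N j) \<in> S) sequentially \<longrightarrow> L \<in> S"
proof -
  define s where "s = (\<lambda>j. empirical \<alpha> (y j) (N j))"
  \<comment> \<open>Every state is invariant under the identity, so
    \<open>invariant_states id\<close> is the compact set of all states.\<close>
  have "s j \<in> invariant_states id" for j
    using empirical_in_states[of "N j" \<alpha> "y j"] N[of j] by (simp add: s_def invariant_states_def)
  then have "\<exists>L\<in>invariant_states id. \<forall>S. closed S \<longrightarrow> eventually (\<lambda>j. s j \<in> S) sequentially \<longrightarrow> L \<in> S"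
    by (intro compact_cluster compact_invariant_states cpt)
  then obtain L where L: "L \<in> invariant_states id"
    "\<forall>S. closed S \<longrightarrow> eventually (\<lambda>j. s j \<in> S) sequentially \<longrightarrow> L \<in> S" by (elim bexE)
  have "L (\<lambda>x. f (\<alpha> x)) = L f" if f: "continuous_on UNIV f" for f
  proof -
    have f\<alpha>: "continuous_on UNIV (\<lambda>x. f (\<alpha> x))"
      using continuous_on_compose[OF \<alpha>, of f] f continuous_on_subset by (auto simp: comp_def)
    obtain C where C: "C > 0" "\<forall>x. \<bar>f x\<bar> \<le> C" using continuous_bounded[OF cpt f] by blast
    have close: "\<bar>s j (\<lambda>x. f (\<alpha> x)) - s j f\<bar> \<le> 2 * C / real (N j)" for j
    proof -
      have "s j (\<lambda>x. f (\<alpha> x)) - s j f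
          = (\<Sum>i<N j. f ((\<alpha> ^^ Suc i) (y j)) - f ((\<alpha> ^^ i) (y j))) / real (N j)"
        using f f\<alpha> by (simp add: s_def empirical_def sum_subtractf diff_divide_distrib)
      also have "(\<Sum>i<N j. f ((\<alpha> ^^ Suc i) (y j)) - f ((\<alpha> ^^ i) (y j)))
          = f ((\<alpha> ^^ N j) (y j)) - f (y j)"
        by (subst sum_lessThan_telescope) simp
      finally have eq: "s j (\<lambda>x. f (\<alpha> x)) - s j f = (f ((\<alpha> ^^ N j) (y j)) - f (y j)) / real (N j)" .
      have "\<bar>f ((\<alpha> ^^ N j) (y j)) - f (y j)\<bar> \<le> 2 * C"
        using C(2)[rule_format, of "(\<alpha> ^^ N j) (y j)"] C(2)[rule_format, of "y j"] by linarith
      then show ?thesis unfolding eq by (simp add: abs_divide divide_right_mono)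
    qed
    have "\<bar>L (\<lambda>x. f (\<alpha> x)) - L f\<bar> \<le> e" if e: "e > 0" for e
    proof -
      have "closed {M. \<bar>M (\<lambda>x. f (\<alpha> x)) - M f\<bar> \<le> e}"
        by (intro closed_Collect_le continuous_intros continuous_on_coordinate)
      moreover have "eventually (\<lambda>j. s j \<in> {M. \<bar>M (\<lambda>x. f (\<alpha> x)) - M f\<bar> \<le> e}) sequentially"
      proof -
        obtain n0 :: nat where n0: "2 * C / e < real n0" using reals_Archimedean2 by blast
        have "2 * C / real (N j) \<le> e" if "j \<ge> n0" for j
        proof -
          have "real n0 < real (N j)" using N[of j] that by simp
          with n0 have "2 * C / e < real (N j)" by linarith
          then have "2 * C < e * real (N j)" using e by (simp add: divide_less_eq mult.commute)
          then show ?thesis using N[of j] by (simp add: divide_le_eq)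
        qed
        then show ?thesis
          using close unfolding eventually_sequentially mem_Collect_eq by (meson order_trans)
      qed
      ultimately have "L \<in> {M. \<bar>M (\<lambda>x. f (\<alpha> x)) - M f\<bar> \<le> e}" using L(2) by blast
      then show ?thesis by simp
    qed
    then have "\<bar>L (\<lambda>x. f (\<alpha> x)) - L f\<bar> \<le> 0" by (rule field_le_epsilon) simp
    then show ?thesis by simp
  qed
  then have "L \<in> invariant_states \<alpha>" using L(1) by (simp add: invariant_states_def)
  with L(2) show ?thesis unfolding s_def by blast
qed

lemma invariant_states_nonempty:
  fixes \<alpha> :: "'a::t2_space \<Rightarrow> 'a"
  assumes "compact (UNIV :: 'a set)" "continuous_on UNIV \<alpha>"
  shows "invariant_states \<alpha> \<noteq> {}"
  \<comment> \<open>Any orbit segments of growing length will do, so an arbitrary sequence of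
    starting points is supplied.\<close>
  using empirical_limit[OF assms, of Suc undefined] by blast

section \<open>Invariant states and invariant measures\<close>

definition state_of :: "'a::topological_space measure \<Rightarrow> ('a \<Rightarrow> real) \<Rightarrow> real" where
  "state_of \<mu> f = (if continuous_on UNIV f then integral\<^sup>L \<mu> f else 0)"

context
  fixes \<alpha> :: "'a::t2_space \<Rightarrow> 'a"
  assumes cpt: "compact (UNIV :: 'a set)" and \<alpha>: "continuous_on UNIV \<alpha>"
begin

lemma measurable_map: "sets \<mu> = sets borel \<Longrightarrow> \<alpha> \<in> measurable \<mu> borel"
  using borel_measurable_continuous_onI[OF \<alpha>] by (simp cong: measurable_cong_sets)

lemma preimage_borel: "A \<in> sets borel \<Longrightarrow> \<alpha> -` A \<in> sets borel"
  using measurable_sets[OF measurable_map[of borel], of A] by simp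

lemma invariant_measuresD:
  assumes "\<mu> \<in> invariant_measures \<alpha>"
  shows "prob_space \<mu>" "finite_measure \<mu>" "regular_borel_measure \<mu>" "sets \<mu> = sets borel"
    "space \<mu> = UNIV" "\<And>A. A \<in> sets borel \<Longrightarrow> emeasure \<mu> (\<alpha> -` A) = emeasure \<mu> A"
    "distr \<mu> borel \<alpha> = \<mu>"
proof -
  show p: "prob_space \<mu>" and r: "regular_borel_measure \<mu>"
    and inv: "\<And>A. A \<in> sets borel \<Longrightarrow> emeasure \<mu> (\<alpha> -` A) = emeasure \<mu> A"
    using assms by (auto simp: invariant_measures_def)
  show "finite_measure \<mu>" using p by (rule prob_space.finite_measure)
  show s: "sets \<mu> = sets borel" using r by (simp add: regular_borel_measure_def)
  then show sp: "space \<mu> = UNIV" using sets_eq_imp_space_eq[OF s] by simp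
  show "distr \<mu> borel \<alpha> = \<mu>"
    by (rule measure_eqI) (use s sp inv measurable_map[OF s] in \<open>auto simp: emeasure_distr\<close>)
qed

lemma state_of_invariant:
  assumes \<mu>: "\<mu> \<in> invariant_measures \<alpha>"
  shows "state_of \<mu> \<in> invariant_states \<alpha>"
proof -
  note m = invariant_measuresD[OF \<mu>]
  interpret prob_space \<mu> by (rule m)
  have i: "integrable \<mu> f" if "continuous_on UNIV f" for f :: "'a \<Rightarrow> real"
    by (rule continuous_integrable[OF cpt that m(2,4)])
  have inv: "integral\<^sup>L \<mu> (\<lambda>x. f (\<alpha> x)) = integral\<^sup>L \<mu> f" if "continuous_on UNIV f" for f :: "'a \<Rightarrow> real"
    using integral_distr[OF measurable_map[OF m(4)] borel_measurable_continuous_onI[OF that]] m(7)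
    by simp
  have c\<alpha>: "continuous_on UNIV (\<lambda>x. f (\<alpha> x))" if "continuous_on UNIV f" for f :: "'a \<Rightarrow> real"
    using continuous_on_compose[OF \<alpha>, of f] that continuous_on_subset by (auto simp: comp_def)
  show ?thesis
    unfolding invariant_states_def states_def state_of_def
    using i inv c\<alpha> prob_space by (auto simp: continuous_intros integral_nonneg_AE)
qed

text \<open>The Riesz measure and its image under \<open>\<alpha>\<close> integrate continuous
  functions alike, by invariance of \<open>L\<close>. The two measures agree once the image is known
  to be regular, and it is, because \<open>\<alpha>\<close> maps compact sets to compact
  sets.\<close>

lemma invariant_measure_of_state:
  assumes inv: "L \<in> invariant_states \<alpha>"
  shows "\<exists>\<mu>\<in>invariant_measures \<alpha>. state_of \<mu> = L"
proof -
  interpret riesz L using cpt inv by unfold_locales (auto simp: invariant_states_def)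
  let ?\<mu> = riesz_measure
  interpret prob_space ?\<mu> by (rule prob_space_riesz)
  have sp: "space ?\<mu> = UNIV" using sets_eq_imp_space_eq[OF sets_riesz] by simp
  note \<alpha>m = measurable_map[OF sets_riesz]
  define \<nu> where "\<nu> = distr ?\<mu> borel \<alpha>"
  have fin: "finite_measure \<nu>"
    unfolding \<nu>_def by (rule finite_measure_distr) (rule \<alpha>m)
  have meas: "measure \<nu> A = measure ?\<mu> (\<alpha> -` A)" if "A \<in> sets borel" for A
    unfolding \<nu>_def using measure_distr[OF \<alpha>m that] sp by simp
  have reg: "regular_borel_measure \<nu>"
  proof (rule regular_borel_measureI[OF cpt fin])
    show "sets \<nu> = sets borel" by (simp add: \<nu>_def)
    fix A :: "'a set" and e :: real assume A: "A \<in> sets borel" and e: "e > 0"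
    obtain K where K: "compact K" "K \<subseteq> \<alpha> -` A" "measure ?\<mu> (\<alpha> -` A) \<le> measure ?\<mu> K + e"
      by (rule regular_borel_measure_inner[OF regular_riesz finite_measure_axioms preimage_borel[OF A] e])
    have "compact (\<alpha> ` K)" using K(1) \<alpha> by (intro compact_continuous_image) (auto intro: continuous_on_subset)
    then have cl: "closed (\<alpha> ` K)" by (rule compact_imp_closed)
    have "measure ?\<mu> K \<le> measure ?\<mu> (\<alpha> -` (\<alpha> ` K))"
      using cl preimage_borel[of "\<alpha> ` K"] sets_riesz by (intro finite_measure_mono) auto
    then have "measure \<nu> A \<le> measure \<nu> (\<alpha> ` K) + e"
      using K(3) meas[OF A] meas[of "\<alpha> ` K"] cl by simp
    then show "\<exists>K. closed K \<and> K \<subseteq> A \<and> measure \<nu> A \<le> measure \<nu> K + e"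
      using cl K(2) by (intro exI[of _ "\<alpha> ` K"]) auto
  qed
  have "\<nu> = ?\<mu>"
  proof (rule regular_borel_measure_eqI[OF cpt fin finite_measure_axioms reg regular_riesz])
    fix f :: "'a \<Rightarrow> real" assume f: "continuous_on UNIV f"
    have c: "continuous_on UNIV (\<lambda>x. f (\<alpha> x))"
      using continuous_on_compose[OF \<alpha>, of f] f continuous_on_subset by (auto simp: comp_def)
    have "L (\<lambda>x. f (\<alpha> x)) = L f" using inv f unfolding invariant_states_def by blast
    then have *: "integral\<^sup>L ?\<mu> (\<lambda>x. f (\<alpha> x)) = integral\<^sup>L ?\<mu> f" by (simp add: integral_riesz f c)
    have "integral\<^sup>L \<nu> f = integral\<^sup>L ?\<mu> (\<lambda>x. f (\<alpha> x))"
      unfolding \<nu>_def by (rule integral_distr[OF \<alpha>m borel_measurable_continuous_onI[OF f]])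
    also note *
    finally show "integral\<^sup>L \<nu> f = integral\<^sup>L ?\<mu> f" .
  qed
  then have "emeasure ?\<mu> (\<alpha> -` A) = emeasure ?\<mu> A" if "A \<in> sets borel" for A
    using emeasure_distr[OF \<alpha>m that] sp by (simp add: \<nu>_def)
  then have "?\<mu> \<in> invariant_measures \<alpha>"
    unfolding invariant_measures_def using regular_riesz prob_space_riesz by simp
  moreover have "state_of ?\<mu> = L"
    by (rule ext) (simp add: state_of_def integral_riesz L_discontinuous)
  ultimately show ?thesis by blast
qed

section \<open>Conditional measures and ergodicity\<close>

lemma conditional_invariant:
  assumes \<mu>: "\<mu> \<in> invariant_measures \<alpha>" and A: "A \<in> sets borel" "\<alpha> -` A = A" "measure \<mu> A > 0"
  shows "uniform_measure \<mu> A \<in> invariant_measures \<alpha>"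
proof -
  note m = invariant_measuresD[OF \<mu>]
  interpret prob_space \<mu> by (rule m)
  let ?\<nu> = "uniform_measure \<mu> A"
  have A0: "emeasure \<mu> A \<noteq> 0" "emeasure \<mu> A \<noteq> \<infinity>" using A(3) by (auto simp: emeasure_eq_measure)
  have meas: "measure ?\<nu> B = measure \<mu> (A \<inter> B) / measure \<mu> A" if "B \<in> sets borel" for B
    using measure_uniform_measure[OF A0, of B] that m(4) by simp
  have p: "prob_space ?\<nu>" by (rule prob_space_uniform_measure[OF A0])
  have "regular_borel_measure ?\<nu>"
  proof (rule regular_borel_measureI[OF cpt prob_space.finite_measure[OF p]])
    show "sets ?\<nu> = sets borel" using m(4) by simp
    fix B :: "'a set" and e :: real assume B: "B \<in> sets borel" and e: "e > 0"
    \<comment> \<open>The tolerance is scaled by \<open>measure \<mu> A\<close> because conditioning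
      divides by it.\<close>
    have "A \<inter> B \<in> sets borel" "e * measure \<mu> A > 0" using A(1,3) B e by auto
    then obtain K where K: "compact K" "K \<subseteq> A \<inter> B" "measure \<mu> (A \<inter> B) \<le> measure \<mu> K + e * measure \<mu> A"
      by (rule regular_borel_measure_inner[OF m(3,2)])
    have cl: "closed K" using K(1) by (rule compact_imp_closed)
    have "A \<inter> K = K" using K(2) by blast
    then have "measure ?\<nu> K = measure \<mu> K / measure \<mu> A" using meas[of K] cl by simp
    moreover have "measure \<mu> (A \<inter> B) / measure \<mu> A \<le> (measure \<mu> K + e * measure \<mu> A) / measure \<mu> A"
      using K(3) A(3) by (intro divide_right_mono) auto
    ultimately have "measure ?\<nu> B \<le> measure ?\<nu> K + e"
      using meas[OF B] A(3) by (simp add: add_divide_distrib)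
    then show "\<exists>K. closed K \<and> K \<subseteq> B \<and> measure ?\<nu> B \<le> measure ?\<nu> K + e"
      using cl K(2) by auto
  qed
  moreover have "emeasure ?\<nu> (\<alpha> -` B) = emeasure ?\<nu> B" if B: "B \<in> sets borel" for B
  proof -
    have "A \<inter> \<alpha> -` B = \<alpha> -` (A \<inter> B)" using A(2) by blast
    then show ?thesis
      using B A(1) m(4) preimage_borel[OF B] m(6)[of "A \<inter> B"] by simp
  qed
  ultimately show ?thesis using p by (simp add: invariant_measures_def)
qed

lemma integral_conditional:
  fixes f :: "'a \<Rightarrow> real"
  assumes \<mu>: "\<mu> \<in> invariant_measures \<alpha>" and A: "A \<in> sets borel" "measure \<mu> A > 0"
    and f: "continuous_on UNIV f"
  shows "integral\<^sup>L (uniform_measure \<mu> A) f = (\<integral>x. indicator A x * f x \<partial>\<mu>) / measure \<mu> A"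
proof -
  note m = invariant_measuresD[OF \<mu>]
  interpret prob_space \<mu> by (rule m)
  have "uniform_measure \<mu> A = density \<mu> (\<lambda>x. ennreal (indicator A x / measure \<mu> A))"
    unfolding uniform_measure_def using A(2)
    by (intro arg_cong[where f="density \<mu>"] ext)
       (auto simp: indicator_def emeasure_eq_measure divide_ennreal ennreal_1[symmetric] simp del: ennreal_1)
  moreover have "integral\<^sup>L (density \<mu> (\<lambda>x. ennreal (indicator A x / measure \<mu> A))) f
      = (\<integral>x. (indicator A x / measure \<mu> A) *\<^sub>R f x \<partial>\<mu>)"
    using A m(4) borel_measurable_continuous_onI[OF f] measurable_cong_sets[OF m(4) refl]
    by (intro integral_density) auto
  moreover have "(\<lambda>x. (indicator A x / measure \<mu> A) *\<^sub>R f x) = (\<lambda>x. indicator A x * f x / measure \<mu> A)"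
    by (simp add: fun_eq_iff)
  ultimately show ?thesis by simp
qed

text \<open>A non-trivial invariant set splits an invariant measure into its two conditional measures.\<close>

lemma ergodic_if_extreme:
  assumes \<mu>: "\<mu> \<in> invariant_measures \<alpha>" and ext: "face (invariant_states \<alpha>) {state_of \<mu>}"
  shows "\<mu> \<in> ergodic_measures \<alpha>"
proof -
  note m = invariant_measuresD[OF \<mu>]
  interpret prob_space \<mu> by (rule m)
  have "emeasure \<mu> A = 0 \<or> emeasure \<mu> A = 1" if A: "A \<in> sets borel" "\<alpha> -` A = A" for A
  proof (rule ccontr)
    assume n: "\<not> (emeasure \<mu> A = 0 \<or> emeasure \<mu> A = 1)"
    then have pos: "0 < measure \<mu> A" and "measure \<mu> A \<noteq> 1"
      by (auto simp: emeasure_eq_measure zero_less_measure_iff)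
    then have less: "measure \<mu> A < 1" using prob_le_1[of A] by linarith
    have A': "- A \<in> sets borel" "\<alpha> -` (- A) = - A" using A by (auto simp: borel_comp)
    have cm: "measure \<mu> (- A) = 1 - measure \<mu> A"
      using prob_compl[of A] A(1) m(4,5) by (simp add: Compl_eq_Diff_UNIV)
    let ?\<nu> = "uniform_measure \<mu> A" and ?\<nu>' = "uniform_measure \<mu> (- A)"
    have inv: "?\<nu> \<in> invariant_measures \<alpha>" "?\<nu>' \<in> invariant_measures \<alpha>"
      using A A' pos less cm by (auto intro!: conditional_invariant[OF \<mu>])
    have split: "state_of \<mu> f = measure \<mu> A * state_of ?\<nu> f + (1 - measure \<mu> A) * state_of ?\<nu>' f" for f
    proof (cases "continuous_on UNIV f")
      case True
      have i: "integrable \<mu> f" by (rule continuous_integrable[OF cpt True m(2,4)])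
      have "integral\<^sup>L \<mu> f = (\<integral>x. indicator A x * f x + indicator (- A) x * f x \<partial>\<mu>)"
        by (intro Bochner_Integration.integral_cong) (auto simp: indicator_def)
      also have "\<dots> = (\<integral>x. indicator A x * f x \<partial>\<mu>) + (\<integral>x. indicator (- A) x * f x \<partial>\<mu>)"
        using integrable_mult_indicator[OF _ i, of A] integrable_mult_indicator[OF _ i, of "- A"]
          A(1) A'(1) m(4) by (intro Bochner_Integration.integral_add) auto
      finally show ?thesis
        using True integral_conditional[OF \<mu> A(1) pos True] integral_conditional[OF \<mu> A'(1) _ True]
          pos less cm by (simp add: state_of_def)
    next
      case False
      then show ?thesis by (simp add: state_of_def)
    qed
    \<comment> \<open>Extremality identifies the conditional measure with \<open>\<mu>\<close>
      itself, yet the conditional measure gives \<open>A\<close> mass 1.\<close>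
    have "state_of ?\<nu> \<in> {state_of \<mu>}"
      by (rule faceD(1)[OF ext _ state_of_invariant[OF inv(1)] state_of_invariant[OF inv(2)] pos less split])
        simp
    then have eq: "state_of ?\<nu> = state_of \<mu>" by simp
    note n1 = invariant_measuresD[OF inv(1)]
    have "?\<nu> = \<mu>"
    proof (rule regular_borel_measure_eqI[OF cpt n1(2) m(2) n1(3) m(3)])
      fix f :: "'a \<Rightarrow> real" assume "continuous_on UNIV f"
      then show "integral\<^sup>L ?\<nu> f = integral\<^sup>L \<mu> f" using fun_cong[OF eq, of f] by (simp add: state_of_def)
    qed
    moreover have "emeasure ?\<nu> A = 1"
      using pos by (intro emeasure_uniform_measure_1) (auto simp: emeasure_eq_measure)
    ultimately show False using n by simp
  qed
  then show ?thesis using \<mu> by (simp add: ergodic_measures_def)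
qed

end

section \<open>The integral of a logarithm\<close>

text \<open>Truncating inside the logarithm evaluates \<open>ln\<close> at positive numbers only and
  keeps the function continuous, so that states can be applied to it.\<close>

definition truncated_ln :: "('a \<Rightarrow> real) \<Rightarrow> nat \<Rightarrow> 'a \<Rightarrow> real" where
  "truncated_ln a k x = ln (max (a x) (exp (- real k)))"

lemma truncated_ln_eq_max:
  "0 \<le> a x \<Longrightarrow> truncated_ln a k x = (if a x = 0 then - real k else max (ln (a x)) (- real k))"
proof -
  assume "0 \<le> a x"
  moreover have "ln (max (a x) (exp (- real k))) = max (ln (a x)) (- real k)" if "0 < a x"
  proof (cases "a x \<le> exp (- real k)")
    case True
    then have "ln (a x) \<le> - real k" using that ln_le_cancel_iff[of "a x" "exp (- real k)"] by simp
    then show ?thesis using True by (simp add: max_def)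
  next
    case False
    then have "- real k \<le> ln (a x)" using that ln_le_cancel_iff[of "exp (- real k)" "a x"] by simp
    then show ?thesis using False by (simp add: max_def)
  qed
  ultimately show ?thesis by (auto simp: truncated_ln_def max_def)
qed

lemma truncated_ln_antimono: "0 \<le> a x \<Longrightarrow> j \<le> k \<Longrightarrow> truncated_ln a k x \<le> truncated_ln a j x"
  by (auto simp: truncated_ln_eq_max max_def)

lemma ln_le_truncated_ln: "0 < a x \<Longrightarrow> ln (a x) \<le> truncated_ln a k x"
  by (auto simp: truncated_ln_eq_max)

lemma continuous_truncated_ln:
  assumes "continuous_on UNIV a"
  shows "continuous_on UNIV (truncated_ln a k)"
proof -
  have "0 < max (a x) (exp (- real k))" for x by (simp add: less_max_iff_disj)
  then have "max (a x) (exp (- real k)) \<noteq> 0" for x by (metis less_irrefl)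
  then show ?thesis
    unfolding truncated_ln_def using assms by (intro continuous_intros) auto
qed

text \<open>Truncating at the nonpositive level \<open>-k\<close> changes only the negative part, so
  the positive part is the same for all \<open>k\<close>.\<close>

lemma e2ennreal_ln: "0 \<le> a x \<Longrightarrow> e2ennreal (ln_ereal (ereal (a x))) = ennreal (truncated_ln a k x)"
  using ennreal_neg[of "ln (a x)"] of_nat_0_le_iff[of k]
  by (fastforce simp: ln_ereal_def truncated_ln_eq_max e2ennreal_neg max_def ennreal_neg)

lemma e2ennreal_minus_ln:
  assumes "0 \<le> a x"
  shows "e2ennreal (- ln_ereal (ereal (a x))) = (SUP k. ennreal (- truncated_ln a k x))"
proof (cases "a x = 0")
  case True
  then show ?thesis
    by (simp add: ln_ereal_def truncated_ln_eq_max ennreal_SUP_of_nat_eq_top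
        flip: ennreal_of_nat_eq_real_of_nat)
next
  case False
  then have pos: "0 < a x" using assms by simp
  then have "e2ennreal (- ln_ereal (ereal (a x))) = ennreal (- ln (a x))" by (simp add: ln_ereal_def)
  also have "\<dots> = (SUP k. ennreal (- truncated_ln a k x))"
  proof (rule antisym)
    obtain k :: nat where "- ln (a x) \<le> real k" using real_arch_simple by blast
    then have "- truncated_ln a k x = - ln (a x)" using pos by (simp add: truncated_ln_eq_max)
    then show "ennreal (- ln (a x)) \<le> (SUP k. ennreal (- truncated_ln a k x))"
      by (metis SUP_upper UNIV_I)
    show "(SUP k. ennreal (- truncated_ln a k x)) \<le> ennreal (- ln (a x))"
      using ln_le_truncated_ln[of a x, OF pos] by (intro SUP_least ennreal_leI) simp
  qed
  finally show ?thesis .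
qed

lemma enn2ereal_SUP: "enn2ereal (SUP k::nat. f k) = (SUP k. enn2ereal (f k))"
proof -
  have "0 \<le> (SUP k. enn2ereal (f k))" by (rule SUP_upper2[of 0]) (simp_all add: enn2ereal_nonneg)
  then show ?thesis by (simp add: Sup_ennreal.rep_eq image_comp comp_def max_absorb2)
qed

context
  fixes \<mu> :: "'a::t2_space measure" and a :: "'a \<Rightarrow> real"
  assumes cpt: "compact (UNIV :: 'a set)" and \<mu>: "prob_space \<mu>" "sets \<mu> = sets borel"
    and a: "continuous_on UNIV a" "\<And>x. 0 \<le> a x"
begin

lemma integrable_truncated_ln: "integrable \<mu> (truncated_ln a k)"
  by (rule continuous_integrable[OF cpt continuous_truncated_ln[OF a(1)] prob_space.finite_measure[OF \<mu>(1)] \<mu>(2)])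

lemma truncated_ln_measurable: "truncated_ln a k \<in> borel_measurable \<mu>"
  using integrable_truncated_ln by (rule borel_measurable_integrable)

lemma nn_integral_minus_ln:
  "(\<integral>\<^sup>+x. e2ennreal (- ln_ereal (ereal (a x))) \<partial>\<mu>) = (SUP k. \<integral>\<^sup>+x. ennreal (- truncated_ln a k x) \<partial>\<mu>)"
proof -
  have "incseq (\<lambda>k x. ennreal (- truncated_ln a k x))"
    using truncated_ln_antimono[of a, OF a(2)] by (intro incseq_SucI le_funI ennreal_leI) simp
  then show ?thesis
    unfolding e2ennreal_minus_ln[of a, OF a(2)] using truncated_ln_measurable
    by (intro nn_integral_monotone_convergence_SUP) auto
qed

text \<open>The common positive part has finite integral and the negative parts increase with
  \<open>k\<close>, so monotone convergence turns the integral into an infimum of integrals of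
  continuous functions. In this form it can be read off a state.\<close>

lemma integral_ln_eq_INF: "integral_ln a \<mu> = (INF k. ereal (integral\<^sup>L \<mu> (truncated_ln a k)))"
proof -
  define P where "P = (\<integral>\<^sup>+x. e2ennreal (ln_ereal (ereal (a x))) \<partial>\<mu>)"
  define N where "N = (\<lambda>k. \<integral>\<^sup>+x. ennreal (- truncated_ln a k x) \<partial>\<mu>)"
  have P: "P = (\<integral>\<^sup>+x. ennreal (truncated_ln a k x) \<partial>\<mu>)" for k
    unfolding P_def by (intro nn_integral_cong e2ennreal_ln a(2))
  have fin: "P \<noteq> \<infinity>" "N k \<noteq> \<infinity>" for k
    using integrable_truncated_ln[of 0] integrable_truncated_ln[of k]
    unfolding real_integrable_def P[of 0] N_def by auto
  have e: "enn2ereal r = ereal (enn2real r)" if "r \<noteq> \<infinity>" for r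
    using that by (cases r rule: ennreal_cases) auto
  have "enn2ereal P - enn2ereal (N k) = ereal (integral\<^sup>L \<mu> (truncated_ln a k))" for k
    using real_lebesgue_integral_def[OF integrable_truncated_ln[of k]]
    unfolding e[OF fin(1)] e[OF fin(2)] unfolding P[of k] N_def by simp
  then have "(INF k. ereal (integral\<^sup>L \<mu> (truncated_ln a k))) = (INF k. enn2ereal P - enn2ereal (N k))"
    by simp
  also have "\<dots> = enn2ereal P - (SUP k. enn2ereal (N k))"
    using e[OF fin(1)] by (intro INF_ereal_minus_right) auto
  also have "\<dots> = integral_ln a \<mu>"
    unfolding integral_ln_def ereal_integral_def nn_integral_minus_ln
    by (simp add: P_def N_def enn2ereal_SUP)
  finally show ?thesis ..
qed

text \<open>The positive part has finite integral because \<open>a\<close> is bounded, so once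
  -infinity is excluded the negative part is finite too, and \<open>ln_ereal\<close> agrees almost
  everywhere with the real logarithm.\<close>

lemma integral_ln_integrable:
  assumes fin: "integral_ln a \<mu> \<noteq> -\<infinity>"
  shows "AE x in \<mu>. 0 < a x" "integrable \<mu> (\<lambda>x. ln (a x))"
    "integral_ln a \<mu> = ereal (\<integral>x. ln (a x) \<partial>\<mu>)"
proof -
  define P where "P = (\<integral>\<^sup>+x. e2ennreal (ln_ereal (ereal (a x))) \<partial>\<mu>)"
  define N where "N = (\<integral>\<^sup>+x. e2ennreal (- ln_ereal (ereal (a x))) \<partial>\<mu>)"
  have il: "integral_ln a \<mu> = enn2ereal P - enn2ereal N"
    by (simp add: integral_ln_def ereal_integral_def P_def N_def)
  have "P = (\<integral>\<^sup>+x. ennreal (truncated_ln a 0 x) \<partial>\<mu>)"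
    unfolding P_def by (intro nn_integral_cong e2ennreal_ln a(2))
  then have P: "P \<noteq> \<infinity>" using integrable_truncated_ln[of 0] unfolding real_integrable_def by auto
  have e: "enn2ereal r = ereal (enn2real r)" if "r \<noteq> \<infinity>" for r
    using that by (cases r rule: ennreal_cases) auto
  have N: "N \<noteq> \<infinity>"
    using fin e[OF P] unfolding il by auto
  have "(\<lambda>x. e2ennreal (- ln_ereal (ereal (a x)))) \<in> borel_measurable \<mu>"
    unfolding e2ennreal_minus_ln[of a, OF a(2)] using truncated_ln_measurable by auto
  from nn_integral_PInf_AE[OF this] N
  have "AE x in \<mu>. e2ennreal (- ln_ereal (ereal (a x))) \<noteq> \<infinity>" by (simp add: N_def)
  then show pos: "AE x in \<mu>. 0 < a x"
  proof eventually_elim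
    case (elim x)
    then show ?case using a(2)[of x] by (cases "a x = 0") (auto simp: ln_ereal_def)
  qed
  have meas: "(\<lambda>x. ln (a x)) \<in> borel_measurable \<mu>"
    using borel_measurable_continuous_onI[OF a(1)] measurable_cong_sets[OF \<mu>(2) refl]
    by (intro borel_measurable_ln) auto
  have N': "N = (\<integral>\<^sup>+x. ennreal (- ln (a x)) \<partial>\<mu>)"
    unfolding N_def by (intro nn_integral_cong_AE) (use pos in eventually_elim, simp add: ln_ereal_def)
  have P': "P = (\<integral>\<^sup>+x. ennreal (ln (a x)) \<partial>\<mu>)"
    unfolding P_def by (intro nn_integral_cong_AE) (use pos in eventually_elim, simp add: ln_ereal_def)
  show int: "integrable \<mu> (\<lambda>x. ln (a x))"
    unfolding real_integrable_def using meas P N by (simp flip: N' P')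
  show "integral_ln a \<mu> = ereal (\<integral>x. ln (a x) \<partial>\<mu>)"
    unfolding il using real_lebesgue_integral_def[OF int] by (simp add: e[OF P] e[OF N] flip: N' P')
qed

end

lemma le_ln_ereal_iff: "ereal c \<le> ln_ereal x \<longleftrightarrow> ereal (exp c) \<le> x"
proof (cases x)
  case (real r)
  have "\<not> exp c \<le> r" if "r \<le> 0" using that exp_gt_zero[of c] by linarith
  then show ?thesis using real ln_ge_iff[of r c] by (auto simp: ln_ereal_def)
qed (auto simp: ln_ereal_def)

lemma ln_ereal_exp_mult: "ln_ereal (ereal (exp t) * x) = ereal t + ln_ereal x"
proof (cases x)
  case (real r)
  then show ?thesis by (auto simp: ln_ereal_def ln_mult mult_le_0_iff)
qed (auto simp: ln_ereal_def)

lemma ln_ereal_mono: "x \<le> y \<Longrightarrow> ln_ereal x \<le> ln_ereal y"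
  by (cases x y rule: ereal2_cases) (auto simp: ln_ereal_def)

section \<open>Submultiplicative sequences\<close>

text \<open>Fekete's lemma in multiplicative form; the limit is the infimum over
  \<open>n \<ge> 1\<close>. Terms may vanish, so powers are compared directly instead of taking
  logarithms.\<close>

lemma submultiplicative_root_converges:
  fixes b :: "nat \<Rightarrow> real"
  assumes nonneg: "\<And>n. 0 \<le> b n" and sub: "\<And>m n. b (m + n) \<le> b m * b n"
  shows "convergent (\<lambda>n. root n (b n))"
proof -
  define r where "r = (\<lambda>n. root n (b n))"
  have r0: "0 \<le> r n" for n unfolding r_def using nonneg[of n] by (rule real_root_ge_zero)
  define l where "l = Inf (r ` {1..})"
  have bdd: "bdd_below (r ` {1..})" using r0 by (auto intro!: bdd_belowI)
  have l_le: "l \<le> r n" if "n \<ge> 1" for n unfolding l_def using bdd that by (intro cInf_lower) auto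
  have l0: "0 \<le> l" unfolding l_def using r0 by (intro cInf_greatest) auto
  have "r \<longlonglongrightarrow> l"
  proof (rule LIMSEQ_I)
    fix e :: real assume e: "0 < e"
    \<comment> \<open>The margin between \<open>q\<close> and \<open>l + e\<close> absorbs the
      factor \<open>root n D\<close>, which tends to 1.\<close>
    define q where "q = l + e / 2"
    have q: "0 < q" "l < q" "q < l + e" using l0 e by (auto simp: q_def)
    then obtain k where k: "k \<ge> 1" "r k < q"
      using cInf_lessD[of "r ` {1..}" q] by (auto simp: l_def)
    have bk: "b k \<le> q ^ k"
    proof -
      have "b k = r k ^ k" using k(1) nonneg[of k] by (simp add: r_def real_root_pow_pos2)
      also have "\<dots> \<le> q ^ k" using k(2) r0[of k] by (intro power_mono) auto
      finally show ?thesis .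
    qed
    have step: "b (j * k + i) \<le> (q ^ k) ^ j * b i" for i j
    proof (induction j)
      case (Suc j)
      have "b (Suc j * k + i) \<le> b k * b (j * k + i)" using sub[of k "j * k + i"] by (simp add: add.assoc)
      also have "\<dots> \<le> q ^ k * ((q ^ k) ^ j * b i)"
        using Suc bk nonneg q(1) by (intro mult_mono) auto
      finally show ?case by (simp add: mult.assoc)
    qed simp
    \<comment> \<open>\<open>D\<close> bounds \<open>b i / q ^ i\<close> for all remainders
      \<open>i\<close> below \<open>k\<close>; the summand 1 makes it positive, so that
      \<open>root n D\<close> tends to 1.\<close>
    define D where "D = 1 + (\<Sum>i<k. b i / q ^ i)"
    have Dnn: "0 \<le> (\<Sum>i<k. b i / q ^ i)" using nonneg q(1) by (intro sum_nonneg) auto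
    then have D: "0 < D" by (simp add: D_def)
    have bD: "b n \<le> D * q ^ n" for n
    proof -
      have n: "n = (n div k) * k + n mod k" by simp
      have "n mod k < k" using k(1) by simp
      then have "b (n mod k) / q ^ (n mod k) \<le> (\<Sum>i<k. b i / q ^ i)"
        using nonneg q(1) by (intro member_le_sum) auto
      then have "b (n mod k) / q ^ (n mod k) \<le> D" by (simp add: D_def)
      then have bm: "b (n mod k) \<le> D * q ^ (n mod k)" using q(1) by (simp add: divide_le_eq)
      have "b n \<le> (q ^ k) ^ (n div k) * b (n mod k)"
        using step[of "n div k" "n mod k"] by simp
      also have "\<dots> \<le> (q ^ k) ^ (n div k) * (D * q ^ (n mod k))"
        using bm q(1) by (intro mult_left_mono) auto
      also have "\<dots> = D * (q ^ (k * (n div k)) * q ^ (n mod k))" by (simp add: power_mult)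
      also have "\<dots> = D * q ^ (k * (n div k) + n mod k)" by (simp only: power_add)
      also have "\<dots> = D * q ^ n" by simp
      finally show ?thesis .
    qed
    have "(\<lambda>n. root n D * q) \<longlonglongrightarrow> 1 * q"
      by (intro tendsto_mult LIMSEQ_root_const D tendsto_const)
    then have "eventually (\<lambda>n. root n D * q < l + e) sequentially"
      using q(3) by (intro order_tendstoD(2)) auto
    then obtain n0 where n0: "\<And>n. n \<ge> n0 \<Longrightarrow> root n D * q < l + e"
      unfolding eventually_sequentially by blast
    have "norm (r n - l) < e" if n: "n \<ge> max 1 n0" for n
    proof -
      have n1: "n > 0" using n by simp
      have "r n \<le> root n (D * q ^ n)" unfolding r_def using bD n1 by (intro real_root_le_mono) auto
      also have "\<dots> = root n D * q" using n1 q(1) by (simp add: real_root_mult real_root_power_cancel)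
      also have "\<dots> < l + e" using n0 n by simp
      finally show ?thesis using l_le[of n] n by simp
    qed
    then show "\<exists>no. \<forall>n\<ge>no. norm (r n - l) < e" by blast
  qed
  then show ?thesis unfolding r_def convergent_def by blast
qed

section \<open>The essential set\<close>

lemma closed_essential_set: "closed (essential_set \<alpha>)"
proof -
  have "- essential_set \<alpha> = \<Union>{V. open V \<and> (\<forall>\<mu>\<in>invariant_measures \<alpha>. emeasure \<mu> V = 0)}"
    unfolding essential_set_def by (fastforce simp: zero_less_iff_neq_zero)
  moreover have "open (\<Union>{V. open V \<and> (\<forall>\<mu>\<in>invariant_measures \<alpha>. emeasure \<mu> V = 0)})"
    by (rule open_Union) simp
  ultimately show ?thesis by (simp add: closed_def)
qed

lemma essential_set_map:
  assumes \<alpha>: "continuous_on UNIV \<alpha>" and x: "x \<in> essential_set \<alpha>"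
  shows "\<alpha> x \<in> essential_set \<alpha>"
  unfolding essential_set_def mem_Collect_eq
proof (intro allI impI)
  fix V assume V: "open V \<and> \<alpha> x \<in> V"
  then have "open (\<alpha> -` V)" using \<alpha> by (simp add: continuous_on_open_vimage)
  then obtain \<mu> where \<mu>: "\<mu> \<in> invariant_measures \<alpha>" "emeasure \<mu> (\<alpha> -` V) > 0"
    using x V unfolding essential_set_def by auto
  then have "emeasure \<mu> V > 0" using V by (simp add: invariant_measures_def)
  with \<mu>(1) show "\<exists>\<mu>\<in>invariant_measures \<alpha>. emeasure \<mu> V > 0" by blast
qed

lemma essential_set_funpow:
  "continuous_on UNIV \<alpha> \<Longrightarrow> x \<in> essential_set \<alpha> \<Longrightarrow> (\<alpha> ^^ n) x \<in> essential_set \<alpha>"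
  by (induction n) (simp_all add: essential_set_map)

text \<open>Only inner regularity carries null sets from points to the complement of the essential set,
  as \<open>X\<close> need not be second countable.\<close>

lemma AE_essential:
  fixes \<alpha> :: "'a::t2_space \<Rightarrow> 'a"
  assumes cpt: "compact (UNIV :: 'a set)" and \<alpha>: "continuous_on UNIV \<alpha>"
    and \<mu>: "\<mu> \<in> invariant_measures \<alpha>"
  shows "AE x in \<mu>. x \<in> essential_set \<alpha>"
proof -
  note m = invariant_measuresD[OF cpt \<alpha> \<mu>]
  have null: "emeasure \<mu> K = 0" if K: "compact K" "K \<subseteq> - essential_set \<alpha>" for K
  proof -
    have "\<exists>V. open V \<and> x \<in> V \<and> emeasure \<mu> V = 0" if "x \<in> K" for x
    proof -
      have "x \<notin> essential_set \<alpha>" using that K(2) by blast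
      then obtain V where "open V" "x \<in> V" "\<not> 0 < emeasure \<mu> V"
        using \<mu> unfolding essential_set_def by blast
      then show ?thesis by (auto simp: zero_less_iff_neq_zero)
    qed
    then have "K \<subseteq> \<Union>{V. open V \<and> emeasure \<mu> V = 0}" by blast
    then have "\<exists>D\<subseteq>{V. open V \<and> emeasure \<mu> V = 0}. finite D \<and> K \<subseteq> \<Union>D"
      using K(1)[unfolded compact_eq_Heine_Borel, rule_format, of "{V. open V \<and> emeasure \<mu> V = 0}"]
      by simp
    then obtain D where D: "D \<subseteq> {V. open V \<and> emeasure \<mu> V = 0}" "finite D" "K \<subseteq> \<Union>D"
      by (elim exE conjE)
    have "{V. open V \<and> emeasure \<mu> V = 0} \<subseteq> null_sets \<mu>"
      by (auto intro!: null_setsI simp: m(4))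
    with D(1,2) have "\<Union>D \<in> null_sets \<mu>" by (intro null_sets.finite_Union) auto
    then show ?thesis by (intro emeasure_eq_0[OF _ _ D(3)] null_setsD1 null_setsD2)
  qed
  have "emeasure \<mu> (- essential_set \<alpha>) =
      (SUP K\<in>{K. compact K \<and> K \<in> sets borel \<and> K \<subseteq> - essential_set \<alpha>}. emeasure \<mu> K)"
    using m(3) closed_essential_set[of \<alpha>] unfolding regular_borel_measure_def
    by (auto simp: borel_comp)
  also have "\<dots> \<le> 0" using null by (intro SUP_least) auto
  finally have "emeasure \<mu> (- essential_set \<alpha>) = 0" by simp
  then have "- essential_set \<alpha> \<in> null_sets \<mu>"
    using m(4) closed_essential_set[of \<alpha>] by (intro null_setsI) (simp_all add: borel_comp)
  then show ?thesis by (rule AE_I') auto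
qed

lemma ess_preimage_0: "x \<in> essential_set \<alpha> \<Longrightarrow> ess_preimage \<alpha> 0 x = {x}"
  by (auto simp: ess_preimage_def)

text \<open>The intermediate point \<open>(\<alpha> ^^ m) y\<close> of an essential orbit is again
  essential, so restricting to essential points is compatible with composing preimages.\<close>

lemma ess_preimage_add:
  assumes "continuous_on UNIV \<alpha>"
  shows "ess_preimage \<alpha> (m + n) x = (\<Union>z\<in>ess_preimage \<alpha> n x. ess_preimage \<alpha> m z)"
proof -
  have "(\<alpha> ^^ (m + n)) y = (\<alpha> ^^ n) ((\<alpha> ^^ m) y)" for y
    by (simp add: funpow_add add.commute[of m])
  then show ?thesis
    using essential_set_funpow[OF assms] by (auto simp: ess_preimage_def)
qed

lemma ess_preimage_bound:
  assumes \<alpha>: "continuous_on UNIV \<alpha>" and "finite_sheeted_on_essential \<alpha>"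
  shows "\<exists>N. \<forall>n. \<forall>x\<in>essential_set \<alpha>. finite (ess_preimage \<alpha> n x) \<and> card (ess_preimage \<alpha> n x) \<le> N ^ n"
proof -
  obtain N where N: "\<forall>x\<in>essential_set \<alpha>. finite (ess_preimage \<alpha> 1 x) \<and> card (ess_preimage \<alpha> 1 x) \<le> N"
    using assms(2) unfolding finite_sheeted_on_essential_def ess_preimage_def by auto
  have "finite (ess_preimage \<alpha> n x) \<and> card (ess_preimage \<alpha> n x) \<le> N ^ n"
    if x: "x \<in> essential_set \<alpha>" for n x
  proof (induction n)
    case 0
    then show ?case using x by (simp add: ess_preimage_0)
  next
    case (Suc n)
    have eq: "ess_preimage \<alpha> (Suc n) x = (\<Union>z\<in>ess_preimage \<alpha> n x. ess_preimage \<alpha> 1 z)"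
      using ess_preimage_add[OF \<alpha>, of 1 n x] by simp
    have z: "z \<in> essential_set \<alpha>" if "z \<in> ess_preimage \<alpha> n x" for z
      using that by (simp add: ess_preimage_def)
    have "card (ess_preimage \<alpha> (Suc n) x) \<le> (\<Sum>z\<in>ess_preimage \<alpha> n x. card (ess_preimage \<alpha> 1 z))"
      unfolding eq using Suc by (intro card_UN_le) simp
    also have "\<dots> \<le> (\<Sum>z\<in>ess_preimage \<alpha> n x. N)" using N z by (intro sum_mono) blast
    also have "\<dots> \<le> N ^ Suc n" using Suc by (simp add: mult.commute)
    finally have "card (ess_preimage \<alpha> (Suc n) x) \<le> N ^ Suc n" .
    moreover have "finite (ess_preimage \<alpha> (Suc n) x)" unfolding eq using Suc N z by blast
    ultimately show ?case by blast
  qed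
  then show ?thesis by blast
qed

section \<open>The variational inequalities\<close>

definition birkhoff_product :: "('a \<Rightarrow> 'a) \<Rightarrow> ('a \<Rightarrow> real) \<Rightarrow> nat \<Rightarrow> 'a \<Rightarrow> real" where
  "birkhoff_product \<alpha> a n y = (\<Prod>i<n. a ((\<alpha> ^^ i) y))"

lemma birkhoff_product_add:
  "birkhoff_product \<alpha> a (m + n) y = birkhoff_product \<alpha> a m y * birkhoff_product \<alpha> a n ((\<alpha> ^^ m) y)"
proof (induction n)
  case (Suc n)
  have "(\<alpha> ^^ (m + n)) y = (\<alpha> ^^ n) ((\<alpha> ^^ m) y)"
    by (simp add: funpow_add add.commute[of m])
  with Suc show ?case by (simp add: birkhoff_product_def mult.assoc)
qed (simp add: birkhoff_product_def)

text \<open>The \<open>n\<close>-th power of the transfer operator with weight \<open>a\<close>,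
  applied to the constant 1 and evaluated at \<open>x\<close>.\<close>

definition transfer_sum :: "('a::topological_space \<Rightarrow> 'a) \<Rightarrow> ('a \<Rightarrow> real) \<Rightarrow> nat \<Rightarrow> 'a \<Rightarrow> real" where
  "transfer_sum \<alpha> a n x = (\<Sum>y\<in>ess_preimage \<alpha> n x. birkhoff_product \<alpha> a n y)"

text \<open>A supremum in the reals, meaningful for a bounded family over a nonempty set;
  \<open>transfer_sum_bdd\<close> and \<open>essential_set_nonempty\<close> secure this.\<close>

definition transfer_sup :: "('a::topological_space \<Rightarrow> 'a) \<Rightarrow> ('a \<Rightarrow> real) \<Rightarrow> nat \<Rightarrow> real" where
  "transfer_sup \<alpha> a n = (SUP x\<in>essential_set \<alpha>. transfer_sum \<alpha> a n x)"

context
  fixes \<alpha> :: "'a::t2_space \<Rightarrow> 'a" and a :: "'a \<Rightarrow> real"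
  assumes cpt: "compact (UNIV :: 'a set)" and \<alpha>: "continuous_on UNIV \<alpha>"
    and sheets: "finite_sheeted_on_essential \<alpha>"
    and a: "continuous_on UNIV a" and a_nonneg: "\<And>x. 0 \<le> a x"
begin

section \<open>Growth of the transfer sums\<close>

lemma finite_ess_preimage: "x \<in> essential_set \<alpha> \<Longrightarrow> finite (ess_preimage \<alpha> n x)"
  using ess_preimage_bound[OF \<alpha> sheets] by blast

lemma birkhoff_nonneg: "0 \<le> birkhoff_product \<alpha> a n y"
  unfolding birkhoff_product_def using a_nonneg by (intro prod_nonneg) simp

lemma transfer_sum_nonneg: "0 \<le> transfer_sum \<alpha> a n x"
  unfolding transfer_sum_def using birkhoff_nonneg by (intro sum_nonneg) simp

lemma transfer_sum_bdd: "bdd_above (transfer_sum \<alpha> a n ` essential_set \<alpha>)"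
proof -
  obtain A where A: "A > 0" "\<forall>x. \<bar>a x\<bar> \<le> A" using continuous_bounded[OF cpt a] by blast
  obtain N where N: "\<And>n x. x \<in> essential_set \<alpha> \<Longrightarrow> card (ess_preimage \<alpha> n x) \<le> N ^ n"
    using ess_preimage_bound[OF \<alpha> sheets] by blast
  have "birkhoff_product \<alpha> a n y \<le> A ^ n" for y
  proof -
    have "birkhoff_product \<alpha> a n y \<le> (\<Prod>i<n. A)"
      unfolding birkhoff_product_def using a_nonneg A(2) by (intro prod_mono) (auto simp: abs_le_iff)
    then show ?thesis by simp
  qed
  then have "transfer_sum \<alpha> a n x \<le> (\<Sum>y\<in>ess_preimage \<alpha> n x. A ^ n)" for x
    unfolding transfer_sum_def by (intro sum_mono)
  then have "transfer_sum \<alpha> a n x \<le> real (N ^ n) * A ^ n" if "x \<in> essential_set \<alpha>" for x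
    using N[OF that, of n] A(1)
    by (auto intro: order_trans[OF _ mult_right_mono[of "real (card (ess_preimage \<alpha> n x))"]]
        simp: of_nat_le_iff simp del: of_nat_power)
  then show ?thesis by (auto intro!: bdd_aboveI)
qed

lemma transfer_sum_le_sup: "x \<in> essential_set \<alpha> \<Longrightarrow> transfer_sum \<alpha> a n x \<le> transfer_sup \<alpha> a n"
  unfolding transfer_sup_def by (rule cSUP_upper[OF _ transfer_sum_bdd])

lemma birkhoff_le_sup:
  assumes y: "y \<in> essential_set \<alpha>"
  shows "birkhoff_product \<alpha> a n y \<le> transfer_sup \<alpha> a n"
proof -
  let ?x = "(\<alpha> ^^ n) y"
  have x: "?x \<in> essential_set \<alpha>" using essential_set_funpow[OF \<alpha> y] .
  have "y \<in> ess_preimage \<alpha> n ?x" using y by (simp add: ess_preimage_def)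
  then have "birkhoff_product \<alpha> a n y \<le> transfer_sum \<alpha> a n ?x"
    unfolding transfer_sum_def using birkhoff_nonneg finite_ess_preimage[OF x]
    by (intro member_le_sum) auto
  then show ?thesis using transfer_sum_le_sup[OF x, of n] by simp
qed

lemma invariant_measures_nonempty: "invariant_measures \<alpha> \<noteq> {}"
  using invariant_states_nonempty[OF cpt \<alpha>] invariant_measure_of_state[OF cpt \<alpha>] by blast

lemma essential_set_nonempty: "essential_set \<alpha> \<noteq> {}"
proof
  assume empty: "essential_set \<alpha> = {}"
  obtain \<mu> where \<mu>: "\<mu> \<in> invariant_measures \<alpha>" using invariant_measures_nonempty by blast
  interpret prob_space \<mu> by (rule invariant_measuresD[OF cpt \<alpha> \<mu>])
  show False using AE_essential[OF cpt \<alpha> \<mu>] by (simp add: empty)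
qed

lemma transfer_sup_nonneg: "0 \<le> transfer_sup \<alpha> a n"
  using essential_set_nonempty birkhoff_le_sup birkhoff_nonneg by (meson ex_in_conv order_trans)

text \<open>Preimages of order \<open>m + n\<close> are grouped by their image \<open>z\<close>
  under \<open>\<alpha> ^^ m\<close>. The product splits along the orbit at \<open>z\<close>, and
  the inner sum over the preimages of \<open>z\<close> is bounded uniformly in
  \<open>z\<close>.\<close>

lemma transfer_sup_submultiplicative:
  "transfer_sup \<alpha> a (m + n) \<le> transfer_sup \<alpha> a m * transfer_sup \<alpha> a n"
  unfolding transfer_sup_def[of \<alpha> a "m + n"]
proof (rule cSUP_least[OF essential_set_nonempty])
  fix x assume x: "x \<in> essential_set \<alpha>"
  have z: "z \<in> essential_set \<alpha>" if "z \<in> ess_preimage \<alpha> n x" for z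
    using that by (simp add: ess_preimage_def)
  have "transfer_sum \<alpha> a (m + n) x
      = (\<Sum>z\<in>ess_preimage \<alpha> n x. \<Sum>y\<in>ess_preimage \<alpha> m z. birkhoff_product \<alpha> a (m + n) y)"
    unfolding transfer_sum_def ess_preimage_add[OF \<alpha>]
    using finite_ess_preimage x z by (intro sum.UNION_disjoint) (auto simp: ess_preimage_def)
  also have "\<dots> = (\<Sum>z\<in>ess_preimage \<alpha> n x. transfer_sum \<alpha> a m z * birkhoff_product \<alpha> a n z)"
    unfolding transfer_sum_def sum_distrib_right
    by (intro sum.cong refl) (auto simp: birkhoff_product_add ess_preimage_def)
  also have "\<dots> \<le> (\<Sum>z\<in>ess_preimage \<alpha> n x. transfer_sup \<alpha> a m * birkhoff_product \<alpha> a n z)"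
    using z by (intro sum_mono mult_right_mono transfer_sum_le_sup birkhoff_nonneg) auto
  also have "\<dots> = transfer_sup \<alpha> a m * transfer_sum \<alpha> a n x"
    by (simp add: transfer_sum_def sum_distrib_left)
  also have "\<dots> \<le> transfer_sup \<alpha> a m * transfer_sup \<alpha> a n"
    using x by (intro mult_left_mono transfer_sum_le_sup transfer_sup_nonneg)
  finally show "transfer_sum \<alpha> a (m + n) x \<le> transfer_sup \<alpha> a m * transfer_sup \<alpha> a n" .
qed

text \<open>Taking roots is an order isomorphism of the nonnegative reals, so it commutes with
  suprema; the harder inequality is checked by raising an upper bound to the power
  \<open>n\<close>.\<close>

lemma SUP_root_transfer_sum:
  assumes n: "n > 0"
  shows "(SUP x\<in>essential_set \<alpha>. ereal (root n (transfer_sum \<alpha> a n x))) = ereal (root n (transfer_sup \<alpha> a n))"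
proof (rule antisym)
  show "(SUP x\<in>essential_set \<alpha>. ereal (root n (transfer_sum \<alpha> a n x))) \<le> ereal (root n (transfer_sup \<alpha> a n))"
    using n transfer_sum_le_sup by (intro SUP_least) auto
  let ?s = "SUP x\<in>essential_set \<alpha>. ereal (root n (transfer_sum \<alpha> a n x))"
  obtain x0 where x0: "x0 \<in> essential_set \<alpha>" using essential_set_nonempty by blast
  have up: "ereal (root n (transfer_sum \<alpha> a n x)) \<le> ?s" if "x \<in> essential_set \<alpha>" for x
    using that by (rule SUP_upper)
  show "ereal (root n (transfer_sup \<alpha> a n)) \<le> ?s"
  proof (cases ?s)
    case (real r)
    have s: "root n (transfer_sum \<alpha> a n x) \<le> r" if "x \<in> essential_set \<alpha>" for x
      using up[OF that] real by simp
    have "0 \<le> r" using s[OF x0] real_root_ge_zero[OF transfer_sum_nonneg, of n n x0] by linarith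
    have "transfer_sum \<alpha> a n x \<le> r ^ n" if "x \<in> essential_set \<alpha>" for x
    proof -
      have "transfer_sum \<alpha> a n x = root n (transfer_sum \<alpha> a n x) ^ n"
        using n transfer_sum_nonneg by (simp add: real_root_pow_pos2)
      also have "\<dots> \<le> r ^ n"
        by (intro power_mono s that real_root_ge_zero transfer_sum_nonneg)
      finally show ?thesis .
    qed
    then have "transfer_sup \<alpha> a n \<le> r ^ n"
      unfolding transfer_sup_def by (intro cSUP_least essential_set_nonempty)
    then have "root n (transfer_sup \<alpha> a n) \<le> root n (r ^ n)" using n by simp
    then show ?thesis using n \<open>0 \<le> r\<close> real by (simp add: real_root_power_cancel)
  qed (use up[OF x0] in auto)
qed

text \<open>\<open>lim\<close> in the definition denotes a genuine limit only if the sequence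
  converges, which submultiplicativity ensures.\<close>

lemma essential_spectral_potential_eq:
  obtains l where "(\<lambda>n. root n (transfer_sup \<alpha> a n)) \<longlonglongrightarrow> l"
    "essential_spectral_potential \<alpha> a = ln_ereal (ereal l)"
proof -
  obtain l where l: "(\<lambda>n. root n (transfer_sup \<alpha> a n)) \<longlonglongrightarrow> l"
    using submultiplicative_root_converges[OF transfer_sup_nonneg transfer_sup_submultiplicative]
    unfolding convergent_def by (elim exE)
  have "(\<lambda>n. ereal (root n (transfer_sup \<alpha> a n))) \<longlonglongrightarrow> ereal l" using l by simp
  moreover have "eventually (\<lambda>n. ereal (root n (transfer_sup \<alpha> a n)) =
      (SUP x\<in>essential_set \<alpha>. ereal (root n (transfer_sum \<alpha> a n x)))) sequentially"
    using eventually_gt_at_top[of 0] by eventually_elim (simp add: SUP_root_transfer_sum)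
  ultimately have "(\<lambda>n. SUP x\<in>essential_set \<alpha>. ereal (root n (transfer_sum \<alpha> a n x))) \<longlonglongrightarrow> ereal l"
    by (rule Lim_transform_eventually)
  then have "essential_spectral_potential \<alpha> a = ln_ereal (ereal l)"
    unfolding essential_spectral_potential_def transfer_sum_def birkhoff_product_def by (simp add: limI)
  with l show ?thesis using that by blast
qed

section \<open>The lower bound\<close>

lemma distr_funpow:
  assumes \<mu>: "\<mu> \<in> invariant_measures \<alpha>"
  shows "\<alpha> ^^ i \<in> measurable \<mu> \<mu>" "distr \<mu> \<mu> (\<alpha> ^^ i) = \<mu>"
proof -
  note m = invariant_measuresD[OF cpt \<alpha> \<mu>]
  have \<alpha>m: "\<alpha> \<in> measurable \<mu> \<mu>"
    using measurable_map[OF cpt \<alpha> m(4)] measurable_cong_sets[OF refl m(4)] by blast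
  have 1: "distr \<mu> \<mu> \<alpha> = \<mu>" using m(7) distr_cong[OF refl m(4), of \<mu> \<alpha> \<alpha>] by simp
  have "\<alpha> ^^ i \<in> measurable \<mu> \<mu> \<and> distr \<mu> \<mu> (\<alpha> ^^ i) = \<mu>"
  proof (induction i)
    case 0
    show ?case by (simp add: id_def distr_id[unfolded id_def])
  next
    case (Suc i)
    then have "distr \<mu> \<mu> (\<alpha> \<circ> \<alpha> ^^ i) = distr (distr \<mu> \<mu> (\<alpha> ^^ i)) \<mu> \<alpha>"
      using \<alpha>m by (intro distr_distr[symmetric]) auto
    also have "\<dots> = \<mu>" using Suc 1 by (simp only:)
    finally have "distr \<mu> \<mu> (\<alpha> \<circ> \<alpha> ^^ i) = \<mu>" .
    moreover have "\<alpha> \<circ> \<alpha> ^^ i \<in> measurable \<mu> \<mu>"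
      using Suc \<alpha>m by (intro measurable_comp[of _ \<mu> \<mu>]) simp_all
    ultimately show ?case unfolding funpow.simps by (intro conjI)
  qed
  then show "\<alpha> ^^ i \<in> measurable \<mu> \<mu>" "distr \<mu> \<mu> (\<alpha> ^^ i) = \<mu>" by auto
qed

text \<open>Almost every \<open>x\<close> is essential and has \<open>a\<close> positive along its
  orbit segment, so the logarithm of its orbit product is at most that of the supremum. By
  invariance the integral of this logarithm is \<open>real n * c\<close>. The estimate holds for
  each \<open>n\<close> separately.\<close>

lemma integral_ln_le_root:
  assumes \<mu>: "\<mu> \<in> invariant_measures \<alpha>" and n: "n > 0" and c: "integral_ln a \<mu> = ereal c"
  shows "exp c \<le> root n (transfer_sup \<alpha> a n)"
proof -
  note m = invariant_measuresD[OF cpt \<alpha> \<mu>]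
  interpret prob_space \<mu> by (rule m)
  have fin: "integral_ln a \<mu> \<noteq> -\<infinity>" using c by simp
  note il = integral_ln_integrable[OF cpt m(1,4) a a_nonneg fin]
  let ?b = "transfer_sup \<alpha> a n"
  let ?u = "\<lambda>i x. ln (a ((\<alpha> ^^ i) x))"
  have am: "(\<lambda>x. ln (a x)) \<in> borel_measurable \<mu>" using il(2) by (rule borel_measurable_integrable)
  have int: "integrable \<mu> (?u i)" for i
  proof -
    have "integrable (distr \<mu> \<mu> (\<alpha> ^^ i)) (\<lambda>x. ln (a x))" using il(2) distr_funpow(2)[OF \<mu>] by simp
    then show ?thesis by (rule integrable_distr[OF distr_funpow(1)[OF \<mu>]])
  qed
  have eq: "integral\<^sup>L \<mu> (?u i) = c" for i
    using integral_distr[OF distr_funpow(1)[OF \<mu>] am, of i] distr_funpow(2)[OF \<mu>, of i] il(3) c by simp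
  have pos: "AE x in \<mu>. \<forall>i<n. 0 < a ((\<alpha> ^^ i) x)"
  proof -
    have "AE x in \<mu>. 0 < a ((\<alpha> ^^ i) x)" for i
    proof -
      have "AE x in distr \<mu> \<mu> (\<alpha> ^^ i). 0 < a x" unfolding distr_funpow(2)[OF \<mu>] by (rule il(1))
      then show ?thesis by (rule AE_distrD[OF distr_funpow(1)[OF \<mu>]])
    qed
    then have "AE x in \<mu>. \<forall>i. 0 < a ((\<alpha> ^^ i) x)" by (simp add: AE_all_countable)
    then show ?thesis by eventually_elim simp
  qed
  have AE: "AE x in \<mu>. 0 < ?b \<and> (\<Sum>i<n. ?u i x) \<le> ln ?b"
    using pos AE_essential[OF cpt \<alpha> \<mu>]
  proof eventually_elim
    case (elim x)
    have "0 < birkhoff_product \<alpha> a n x" unfolding birkhoff_product_def using elim(1) by (intro prod_pos) auto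
    moreover have "birkhoff_product \<alpha> a n x \<le> ?b" using elim(2) by (rule birkhoff_le_sup)
    moreover have "(\<Sum>i<n. ?u i x) = ln (birkhoff_product \<alpha> a n x)"
      unfolding birkhoff_product_def using elim(1) by (intro ln_prod[symmetric]) auto
    ultimately show ?case by simp
  qed
  then have "AE x in \<mu>. 0 < ?b" by eventually_elim simp
  \<comment> \<open>The assertion does not involve \<open>x\<close>, so on a probability space it
    holds outright; this makes \<open>ln ?b\<close> meaningful.\<close>
  then have b: "0 < ?b" by simp
  have "real n * c = (\<Sum>i<n. integral\<^sup>L \<mu> (?u i))" by (simp add: eq)
  also have "\<dots> = (\<integral>x. (\<Sum>i<n. ?u i x) \<partial>\<mu>)"
    using int by (intro Bochner_Integration.integral_sum[symmetric]) auto
  also have "\<dots> \<le> (\<integral>x. ln ?b \<partial>\<mu>)"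
    using int AE by (intro integral_mono_AE Bochner_Integration.integrable_sum) auto
  also have "\<dots> = ln ?b" using prob_space by simp
  finally have "c \<le> ln ?b / real n" using n by (simp add: field_simps)
  also have "\<dots> = ln (root n ?b)" using n by (simp add: ln_root)
  finally show ?thesis using b n by (simp add: ln_ge_iff)
qed

lemma lower_bound:
  assumes \<mu>: "\<mu> \<in> invariant_measures \<alpha>"
  shows "integral_ln a \<mu> \<le> essential_spectral_potential \<alpha> a"
proof (cases "integral_ln a \<mu>")
  case (real c)
  obtain l where l: "(\<lambda>n. root n (transfer_sup \<alpha> a n)) \<longlonglongrightarrow> l"
    "essential_spectral_potential \<alpha> a = ln_ereal (ereal l)"
    by (rule essential_spectral_potential_eq)
  have "exp c \<le> l"
    using l(1) integral_ln_le_root[OF \<mu> _ real] by (intro LIMSEQ_le_const[OF l(1)] exI[of _ 1]) auto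
  then show ?thesis using real l(2) by (simp add: le_ln_ereal_iff)
next
  \<comment> \<open>A value other than -infinity is the integral of a real integrable function, so
    this case is contradictory.\<close>
  case PInf
  have "integral_ln a \<mu> \<noteq> -\<infinity>" using PInf by simp
  from integral_ln_integrable(3)[OF cpt invariant_measuresD(1,4)[OF cpt \<alpha> \<mu>] a a_nonneg this] PInf
  show ?thesis by simp
qed simp

text \<open>Otherwise empirical measures along a sequence of orbit segments violating the bound accumulate
  at an invariant measure whose integral of \<open>ln a\<close> is at least \<open>t\<close>.\<close>

lemma eventually_birkhoff_le:
  assumes t: "\<And>\<mu>. \<mu> \<in> invariant_measures \<alpha> \<Longrightarrow> integral_ln a \<mu> < ereal t"
  shows "eventually (\<lambda>n. \<forall>y. birkhoff_product \<alpha> a n y \<le> exp (t * real n)) sequentially"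
proof (rule ccontr)
  assume "\<not> ?thesis"
  then have "\<forall>j. \<exists>n y. n > j \<and> exp (t * real n) < birkhoff_product \<alpha> a n y"
    unfolding eventually_sequentially by (metis Suc_le_lessD not_le)
  then obtain N y where Ny: "\<And>j. N j > j" "\<And>j. exp (t * real (N j)) < birkhoff_product \<alpha> a (N j) (y j)"
    by metis
  have "\<exists>L\<in>invariant_states \<alpha>. \<forall>S. closed S \<longrightarrow>
      eventually (\<lambda>j. empirical \<alpha> (y j) (N j) \<in> S) sequentially \<longrightarrow> L \<in> S"
    using Ny(1) by (rule empirical_limit[OF cpt \<alpha>])
  then obtain L where L: "L \<in> invariant_states \<alpha>" "\<forall>S. closed S \<longrightarrow>
      eventually (\<lambda>j. empirical \<alpha> (y j) (N j) \<in> S) sequentially \<longrightarrow> L \<in> S" by (elim bexE)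
  have Lt: "t \<le> L (truncated_ln a k)" for k
  proof -
    \<comment> \<open>\<open>truncated_ln\<close> dominates \<open>ln a\<close>, so for each fixed
      \<open>k\<close> the averages stay above \<open>t\<close>, and this is a closed condition on
      functionals.\<close>
    have "t \<le> empirical \<alpha> (y j) (N j) (truncated_ln a k)" for j
    proof -
      have N0: "N j > 0" using Ny(1)[of j] by simp
      have pr: "0 < birkhoff_product \<alpha> a (N j) (y j)"
        using Ny(2)[of j] exp_gt_zero[of "t * real (N j)"] by linarith
      have ap: "\<forall>i<N j. 0 < a ((\<alpha> ^^ i) (y j))"
      proof (intro allI impI, rule ccontr)
        fix i assume that: "i < N j" and "\<not> 0 < a ((\<alpha> ^^ i) (y j))"
        then have "a ((\<alpha> ^^ i) (y j)) = 0" using a_nonneg[of "(\<alpha> ^^ i) (y j)"] by simp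
        then have "birkhoff_product \<alpha> a (N j) (y j) = 0"
          unfolding birkhoff_product_def using that by (intro prod_zero) auto
        with pr show False by simp
      qed
      have "t * real (N j) < ln (birkhoff_product \<alpha> a (N j) (y j))"
        using Ny(2)[of j] pr by (metis ln_exp ln_less_cancel_iff exp_gt_zero)
      also have "\<dots> = (\<Sum>i<N j. ln (a ((\<alpha> ^^ i) (y j))))"
        unfolding birkhoff_product_def using ap by (intro ln_prod) auto
      also have "\<dots> \<le> (\<Sum>i<N j. truncated_ln a k ((\<alpha> ^^ i) (y j)))"
        using ap by (intro sum_mono ln_le_truncated_ln) auto
      finally show ?thesis
        using N0 continuous_truncated_ln[OF a] by (simp add: empirical_def field_simps)
    qed
    then have "eventually (\<lambda>j. empirical \<alpha> (y j) (N j) \<in> {M. t \<le> M (truncated_ln a k)}) sequentially"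
      by simp
    moreover have "closed {M. t \<le> M (truncated_ln a k)}"
      by (intro closed_Collect_le continuous_intros continuous_on_coordinate)
    ultimately have "L \<in> {M. t \<le> M (truncated_ln a k)}" using L(2) by blast
    then show ?thesis by simp
  qed
  obtain \<mu> where \<mu>: "\<mu> \<in> invariant_measures \<alpha>" "state_of \<mu> = L"
    using invariant_measure_of_state[OF cpt \<alpha> L(1)] by blast
  note m = invariant_measuresD[OF cpt \<alpha> \<mu>(1)]
  have "ereal t \<le> integral_ln a \<mu>"
    unfolding integral_ln_eq_INF[OF cpt m(1,4) a a_nonneg]
  proof (rule INF_greatest)
    fix k
    have "integral\<^sup>L \<mu> (truncated_ln a k) = L (truncated_ln a k)"
      unfolding \<mu>(2)[symmetric] state_of_def using continuous_truncated_ln[OF a] by simp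
    then show "ereal t \<le> ereal (integral\<^sup>L \<mu> (truncated_ln a k))" using Lt by simp
  qed
  with t[OF \<mu>(1)] show False by simp
qed

text \<open>A real \<open>t\<close> strictly above all integrals stands in for the maximum, which
  may be -infinity. The preimage counts contribute only a limsup, but the transfer suprema converge,
  so their limit can be compared as a limsup.\<close>

lemma upper_bound_real:
  assumes t: "\<And>\<mu>. \<mu> \<in> invariant_measures \<alpha> \<Longrightarrow> integral_ln a \<mu> < ereal t"
  shows "essential_spectral_potential \<alpha> a \<le> ereal t + inverse_rami_rate \<alpha>"
proof -
  let ?C = "\<lambda>n. SUP x\<in>essential_set \<alpha>. ereal (root n (real (card (ess_preimage \<alpha> n x))))"
  obtain l where l: "(\<lambda>n. root n (transfer_sup \<alpha> a n)) \<longlonglongrightarrow> l"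
    "essential_spectral_potential \<alpha> a = ln_ereal (ereal l)"
    by (rule essential_spectral_potential_eq)
  have "eventually (\<lambda>n. \<forall>y. birkhoff_product \<alpha> a n y \<le> exp (t * real n)) sequentially"
    using t by (rule eventually_birkhoff_le)
  then have ev: "eventually (\<lambda>n. ereal (root n (transfer_sup \<alpha> a n)) \<le> ereal (exp t) * ?C n) sequentially"
    using eventually_gt_at_top[of 0]
  proof eventually_elim
    case (elim n)
    have "ereal (root n (transfer_sum \<alpha> a n x)) \<le> ereal (exp t) * ?C n" if x: "x \<in> essential_set \<alpha>" for x
    proof -
      have "transfer_sum \<alpha> a n x \<le> (\<Sum>y\<in>ess_preimage \<alpha> n x. exp (t * real n))"
        unfolding transfer_sum_def using elim(1) by (intro sum_mono) auto
      also have "\<dots> = real (card (ess_preimage \<alpha> n x)) * exp t ^ n"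
        by (simp add: exp_of_nat_mult[symmetric] mult.commute)
      finally have "root n (transfer_sum \<alpha> a n x) \<le> root n (real (card (ess_preimage \<alpha> n x)) * exp t ^ n)"
        using elim(2) by simp
      also have "\<dots> = exp t * root n (real (card (ess_preimage \<alpha> n x)))"
        using elim(2) by (simp add: real_root_mult real_root_power_cancel)
      finally have "ereal (root n (transfer_sum \<alpha> a n x))
          \<le> ereal (exp t) * ereal (root n (real (card (ess_preimage \<alpha> n x))))" by simp
      also have "\<dots> \<le> ereal (exp t) * ?C n"
        using x by (intro ereal_mult_left_mono SUP_upper) auto
      finally show ?thesis .
    qed
    then show ?case
      unfolding SUP_root_transfer_sum[OF elim(2), symmetric] by (intro SUP_least)
  qed
  have "ereal l = limsup (\<lambda>n. ereal (root n (transfer_sup \<alpha> a n)))"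
    using l(1) by (intro lim_imp_Limsup[symmetric]) auto
  also have "\<dots> \<le> limsup (\<lambda>n. ereal (exp t) * ?C n)" using ev by (rule Limsup_mono)
  also have "\<dots> = ereal (exp t) * limsup ?C" by (rule limsup_ereal_mult_left) simp
  finally have "ln_ereal (ereal l) \<le> ln_ereal (ereal (exp t) * limsup ?C)" by (rule ln_ereal_mono)
  then show ?thesis unfolding l(2) inverse_rami_rate_def ln_ereal_exp_mult .
qed

text \<open>The coordinates of an invariant state at the functions \<open>truncated_ln a k\<close>
  decrease in \<open>k\<close>, and by \<open>integral_ln_eq_INF\<close> their infimum is the
  integral to be maximized. An extreme maximizing state therefore comes from an ergodic
  measure.\<close>

lemma maximum_attained_by_ergodic:
  "\<exists>\<mu>\<in>ergodic_measures \<alpha>. \<forall>\<nu>\<in>invariant_measures \<alpha>. integral_ln a \<nu> \<le> integral_ln a \<mu>"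
proof -
  have dec: "L (truncated_ln a k) \<le> L (truncated_ln a j)" if "L \<in> invariant_states \<alpha>" "j \<le> k" for L j k
  proof -
    interpret riesz L using cpt that(1) by unfold_locales (auto simp: invariant_states_def)
    show ?thesis
      using that(2) continuous_truncated_ln[OF a] truncated_ln_antimono[of a, OF a_nonneg]
      by (intro L_mono) auto
  qed
  have INF: "integral_ln a \<mu> = (INF k. ereal (state_of \<mu> (truncated_ln a k)))"
    if "\<mu> \<in> invariant_measures \<alpha>" for \<mu>
    using integral_ln_eq_INF[OF cpt invariant_measuresD(1,4)[OF cpt \<alpha> that] a a_nonneg]
      continuous_truncated_ln[OF a] by (simp add: state_of_def)
  have "\<exists>L\<in>invariant_states \<alpha>. face (invariant_states \<alpha>) {L} \<and> (\<forall>M\<in>invariant_states \<alpha>.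
      (INF k. ereal (M (truncated_ln a k))) \<le> (INF k. ereal (L (truncated_ln a k))))"
    by (rule extreme_point_maximizes[OF compact_invariant_states[OF cpt]
          invariant_states_nonempty[OF cpt \<alpha>] closed_invariant_states]) (rule dec)
  then obtain L where L: "L \<in> invariant_states \<alpha>" "face (invariant_states \<alpha>) {L}"
    "\<forall>M\<in>invariant_states \<alpha>. (INF k. ereal (M (truncated_ln a k))) \<le> (INF k. ereal (L (truncated_ln a k)))"
    by (elim bexE conjE)
  obtain \<mu> where \<mu>: "\<mu> \<in> invariant_measures \<alpha>" "state_of \<mu> = L"
    using invariant_measure_of_state[OF cpt \<alpha> L(1)] by blast
  have "\<mu> \<in> ergodic_measures \<alpha>"
    using ergodic_if_extreme[OF cpt \<alpha> \<mu>(1)] L(2) \<mu>(2) by simp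
  moreover have "integral_ln a \<nu> \<le> integral_ln a \<mu>" if "\<nu> \<in> invariant_measures \<alpha>" for \<nu>
    unfolding INF[OF that] INF[OF \<mu>(1)] \<mu>(2) using L(3) state_of_invariant[OF cpt \<alpha> that] by blast
  ultimately show ?thesis by blast
qed

lemma integral_ln_less_top: "\<mu> \<in> invariant_measures \<alpha> \<Longrightarrow> integral_ln a \<mu> \<noteq> \<infinity>"
  using integral_ln_integrable(3)[OF cpt invariant_measuresD(1,4)[OF cpt \<alpha>] a a_nonneg, of \<mu>] by (cases "integral_ln a \<mu>") auto

end

theorem theorem16:
  fixes \<alpha> :: "'a::t2_space \<Rightarrow> 'a" and a :: "'a \<Rightarrow> real"
  assumes "compact (UNIV :: 'a set)"
    and "continuous_on UNIV \<alpha>"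
    and "finite_sheeted_on_essential \<alpha>"
    and "continuous_on UNIV a"
    and "\<forall>x. 0 \<le> a x"
  shows "\<exists>m. is_maximum (integral_ln a ` invariant_measures \<alpha>) m
           \<and> is_maximum (integral_ln a ` ergodic_measures \<alpha>) m
           \<and> m \<le> essential_spectral_potential \<alpha> a
           \<and> essential_spectral_potential \<alpha> a \<le> m + inverse_rami_rate \<alpha>"
proof -
  note A = assms(1-4) assms(5)[rule_format]
  obtain \<mu> where \<mu>: "\<mu> \<in> ergodic_measures \<alpha>"
    and max: "\<forall>\<nu>\<in>invariant_measures \<alpha>. integral_ln a \<nu> \<le> integral_ln a \<mu>"
    using maximum_attained_by_ergodic[OF A] by (elim bexE)
  have inv: "\<mu> \<in> invariant_measures \<alpha>" using \<mu> by (simp add: ergodic_measures_def)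
  let ?m = "integral_ln a \<mu>" and ?\<omega> = "inverse_rami_rate \<alpha>"
  have upper: "essential_spectral_potential \<alpha> a \<le> ereal t + ?\<omega>" if "?m < ereal t" for t
    using upper_bound_real[OF A, of t] max that by (meson le_less_trans)
  \<comment> \<open>For finite \<open>?\<omega>\<close>, real \<open>t\<close> decrease to
    \<open>?m\<close>. Finiteness of \<open>?\<omega>\<close> has not been established: if it is
    infinite, the right side is infinite even for \<open>?m = -\<infinity>\<close>, and if it is
    -infinity, a single \<open>t\<close> suffices.\<close>
  have "essential_spectral_potential \<alpha> a \<le> ?m + ?\<omega>"
  proof (cases ?\<omega>)
    case (real w)
    have "essential_spectral_potential \<alpha> a - ereal w \<le> ?m"
    proof (rule dense_ge)
      fix s assume s: "?m < s"
      show "essential_spectral_potential \<alpha> a - ereal w \<le> s"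
      proof (cases s)
        case (real t)
        then show ?thesis
          using upper[of t] s \<open>?\<omega> = ereal w\<close> by (simp add: ereal_minus_le)
      qed (use s in auto)
    qed
    then show ?thesis using real by (simp add: ereal_minus_le)
  next
    case PInf
    then show ?thesis by simp
  next
    case MInf
    obtain t where "?m < ereal t"
      using integral_ln_less_top[OF A inv] less_PInf_Ex_of_nat[of ?m] by auto
    from upper[OF this] MInf show ?thesis by simp
  qed
  moreover have "ergodic_measures \<alpha> \<subseteq> invariant_measures \<alpha>" by (auto simp: ergodic_measures_def)
  ultimately show ?thesis
    using \<mu> inv max lower_bound[OF A inv] unfolding is_maximum_def by (intro exI[of _ ?m]) auto
qed

end
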